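(* For every non-negative integer $n$ we have $$\gamma_H(n)=(-1)^n\zeta^{(n)}(2)+\gamma(n+1)-(-1)^n\frac{\psi^{(n+1)}(1)}{n+1}-(-1)^n\sum_{k=0}^{n}\binom{n}{k}\left(b_k\,i_{n-k}+(-1)^{n-k}\gamma(n-k)\,\psi^{(k)}(1)\right),$$ where $$b_k=\left.\frac{d^k}{ds^k}\frac{1}{\Gamma(s)}\right|_{s=1}\quad\text{and}\quad i_k=\int_0^\infty\frac{e^{-x}\log\left(\frac{1-e^{-x}}{x}\right)\log^k x}{1-e^{-x}}\,dx .$$
   Context: $\zeta$ is the Riemann zeta function, $\zeta^{(n)}$ its $n$-th derivative, and $\psi=\Gamma'/\Gamma$ the digamma function. The Stieltjes constants $\gamma(m)$ are defined by $\zeta(s)=\frac1{s-1}+\sum_{m=0}^\infty(-1)^m\frac{\gamma(m)}{m!}(s-1)^m$. With $H_n=\sum_{k=1}^n\frac1k$, the harmonic zeta function is $\zeta_H(s)=\sum_{n=1}^\infty\frac{H_n}{n^s}$ for $\operatorname{Re}(s)>1$, continued meromorphically to the complex plane; the harmonic Stieltjes constants $\gamma_H(m)$ are defined by $\zeta_H(s)=\frac{1}{(s-1)^2}+\frac{\gamma(0)}{s-1}+\sum_{m=0}^\infty(-1)^m\frac{\gamma_H(m)}{m!}(s-1)^m$ for $0<|s-1|<1$. *)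

theory Defs
  imports "HOL-Complex_Analysis.Complex_Analysis"
begin

text \<open>
  The continuation is normalised by \<open>nicely_meromorphic_on\<close> (removable singularities filled in,
  value \<open>0\<close> at poles). With this convention it is unique as soon as \<open>A\<close> has a limit point
  at which the continuation is analytic.
\<close>

definition meromorphic_continuation ::
    "(complex \<Rightarrow> complex) \<Rightarrow> complex set \<Rightarrow> complex \<Rightarrow> complex" where
  "meromorphic_continuation f A =
     (THE g. g nicely_meromorphic_on UNIV \<and> (\<forall>s\<in>A. g s = f s))"

definition zeta :: "complex \<Rightarrow> complex" where
  "zeta = meromorphic_continuation (\<lambda>s. \<Sum>n. 1 / of_nat (Suc n) powr s) {s. Re s > 1}"

definition harmonic_zeta :: "complex \<Rightarrow> complex" where
  "harmonic_zeta =
     meromorphic_continuation (\<lambda>s. \<Sum>n. harm (Suc n) / of_nat (Suc n) powr s) {s. Re s > 1}"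

text \<open>
  Both sequences of constants are complex-valued here, since they are coefficients of complex
  Laurent expansions; their values happen to be real.
\<close>

definition stieltjes :: "nat \<Rightarrow> complex" where
  "stieltjes = (THE c. \<forall>s. s \<noteq> 1 \<longrightarrow>
     (\<lambda>m. (-1) ^ m * c m / fact m * (s - 1) ^ m) sums (zeta s - 1 / (s - 1)))"

definition harmonic_stieltjes :: "nat \<Rightarrow> complex" where
  "harmonic_stieltjes = (THE c. \<forall>s. 0 < norm (s - 1) \<and> norm (s - 1) < 1 \<longrightarrow>
     (\<lambda>m. (-1) ^ m * c m / fact m * (s - 1) ^ m)
       sums (harmonic_zeta s - 1 / (s - 1)\<^sup>2 - stieltjes 0 / (s - 1)))"

definition inv_Gamma_deriv :: "nat \<Rightarrow> complex" where
  "inv_Gamma_deriv k = (deriv ^^ k) (\<lambda>s. 1 / Gamma s) 1"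

definition log_integral :: "nat \<Rightarrow> real" where
  "log_integral k =
     (LINT x:{0<..}|lborel. exp (-x) * ln ((1 - exp (-x)) / x) * ln x ^ k / (1 - exp (-x)))"

end

theory Submission
  imports Defs
begin

text \<open>
  For \<open>Re s > 1\<close>, \<open>Gamma s * harmonic_zeta s\<close> is the Mellin transform of the function
  \<open>- ln (1 - exp (-x)) / (1 - exp (-x))\<close>. Writing \<open>1 / (1 - exp (-x)) = 1 + exp (-x) / (1 - exp (-x))\<close>
  and splitting \<open>ln x\<close> off the logarithm in the second part gives
  \<open>harmonic_zeta s = zeta (s + 1) - zeta' s - Digamma s * zeta s - I s / Gamma s\<close>, where \<open>I\<close> is the
  Mellin transform of \<open>exp (-x) * ln ((1 - exp (-x)) / x) / (1 - exp (-x))\<close>. This \<open>I\<close> converges for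
  \<open>Re s > 0\<close> and its \<open>k\<close>-th derivative at \<open>1\<close> is \<open>log_integral k\<close>, so the claim is obtained by
  comparing Taylor coefficients at \<open>1\<close>.

  The continuations of \<open>zeta\<close> and \<open>I\<close> to the plane come from integrating the Taylor series of the
  integrand at \<open>0\<close> termwise over \<open>(0, \<delta>]\<close>, which yields a partial fraction series with poles at
  \<open>0, -1, -2, \<dots>\<close>; the rest of the integral is entire.
\<close>

subsection \<open>Mellin transforms\<close>

text \<open>The assertion only concerns a disc around 1, but the definite descriptions reach
  further: \<open>zeta\<close> and \<open>harmonic_zeta\<close> must be identified on the whole
  plane as normalised meromorphic functions, and \<open>stieltjes\<close> asks for an expansion
  valid at every s other than 1. Hence zeta minus its polar part has to be entire, which works
  because the poles of the continued transform to the left of 1 fall on zeros of 1/Gamma. For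
  \<open>harmonic_zeta\<close> a meromorphic continuation suffices, with no control of its
  singularities outside Re s > 0.

  The split of the logarithm is dictated by x = 0: ln((1 - e^-x)/x) vanishes there and cancels the
  factor 1/(1 - e^-x), so I is regular at s = 1 and all singular behaviour sits in zeta' and psi *
  zeta. The term -zeta' supplies the double pole. The term -psi * zeta supplies a simple pole with
  residue -psi(1), which has to match gamma(0); here the value of Euler's constant enters. The
  holomorphic remainder (psi(s) - psi(1))/(s - 1) is the source of the isolated term
  psi^(n+1)(1)/(n+1).\<close>

definition mellin_conv :: "(real \<Rightarrow> real) \<Rightarrow> real \<Rightarrow> bool" where
  "mellin_conv g \<sigma> \<longleftrightarrow> set_integrable lborel {0<..} (\<lambda>x. x powr (\<sigma> - 1) * g x)"

definition mellin :: "(real \<Rightarrow> real) \<Rightarrow> complex \<Rightarrow> complex" where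
  "mellin g s = (LINT x:{0<..}|lborel. of_real x powr (s - 1) * of_real (g x))"

lemma of_real_powr_eq_exp: "x > 0 \<Longrightarrow> complex_of_real x powr s = exp (s * of_real (ln x))"
  by (simp add: powr_def Ln_of_real)

text \<open>On the support of the indicator the complex power is
  \<open>exp (s * of_real (ln x))\<close>, a composition of measurable functions.\<close>

lemma mellin_measurable [measurable]:
  assumes [measurable]: "g \<in> borel_measurable borel"
  shows "(\<lambda>x. indicator {0<..} x *\<^sub>R (complex_of_real x powr s * of_real (g x))) \<in> borel_measurable lborel"
proof -
  have "(\<lambda>x. indicator {0<..} x *\<^sub>R (exp (s * of_real (ln x)) * complex_of_real (g x))) \<in> borel_measurable lborel"
    by measurable
  also have "(\<lambda>x. indicator {0<..} x *\<^sub>R (exp (s * of_real (ln x)) * complex_of_real (g x))) =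
    (\<lambda>x. indicator {0<..} x *\<^sub>R (complex_of_real x powr s * of_real (g x)))"
    by (auto simp: fun_eq_iff indicator_def of_real_powr_eq_exp)
  finally show ?thesis .
qed

text \<open>For x > 0 the modulus of \<open>of_real x powr (s - 1)\<close> is
  \<open>x powr (Re s - 1)\<close>, so absolute convergence depends on the vertical line only; this
  is why \<open>mellin_conv\<close> takes a real argument.\<close>

lemma mellin_conv_iff:
  assumes [measurable]: "g \<in> borel_measurable borel"
  shows "mellin_conv g (Re s) \<longleftrightarrow>
    set_integrable lborel {0<..} (\<lambda>x. of_real x powr (s - 1) * complex_of_real (g x))"
proof -
  have "mellin_conv g (Re s) \<longleftrightarrow> integrable lborel (\<lambda>x. norm (indicator {0<..} x *\<^sub>R (x powr (Re s - 1) * g x)))"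
    unfolding mellin_conv_def set_integrable_def by (subst integrable_norm_iff) auto
  also have "(\<lambda>x. norm (indicator {0<..} x *\<^sub>R (x powr (Re s - 1) * g x))) =
     (\<lambda>x. norm (indicator {0<..} x *\<^sub>R (of_real x powr (s - 1) * complex_of_real (g x))))"
    by (auto simp: fun_eq_iff indicator_def norm_mult norm_powr_real_powr abs_mult)
  also have "integrable lborel \<dots> \<longleftrightarrow>
    set_integrable lborel {0<..} (\<lambda>x. of_real x powr (s - 1) * complex_of_real (g x))"
    unfolding set_integrable_def by (subst integrable_norm_iff) auto
  finally show ?thesis .
qed

text \<open>Two majorants with separate exponents, because a power of the logarithm is dominated by
  different powers of x near 0 and near infinity.\<close>

lemma mellin_conv_bound:
  assumes [measurable]: "g \<in> borel_measurable borel"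
  assumes "mellin_conv f \<sigma>" "mellin_conv h \<tau>"
    and "\<And>x. x > 0 \<Longrightarrow> \<bar>x powr (\<rho> - 1) * g x\<bar> \<le> \<bar>x powr (\<sigma> - 1) * f x\<bar> + \<bar>x powr (\<tau> - 1) * h x\<bar>"
  shows "mellin_conv g \<rho>"
  unfolding mellin_conv_def
proof (rule set_integrable_bound)
  show "set_integrable lborel {0<..} (\<lambda>x. \<bar>x powr (\<sigma> - 1) * f x\<bar> + \<bar>x powr (\<tau> - 1) * h x\<bar>)"
    using assms(2,3) unfolding mellin_conv_def by (intro set_integral_add set_integrable_abs)
  show "set_borel_measurable lborel {0<..} (\<lambda>x. x powr (\<rho> - 1) * g x)"
    unfolding set_borel_measurable_def by measurable
qed (use assms(4) in \<open>auto intro!: AE_I2 order_trans[OF assms(4)]\<close>)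

section \<open>Powers of the logarithm and analyticity in the half-plane of convergence\<close>

lemma exp_abs_ln_le:
  assumes "x > (0::real)" "r \<ge> 0"
  shows "exp (r * \<bar>ln x\<bar>) \<le> x powr r + x powr (-r)"
  using assms by (auto simp: abs_if powr_def)

lemma summable_exp_real: "summable (\<lambda>k. x ^ k / fact k :: real)"
  using summable_exp_generic[of x] by (simp add: divide_inverse mult.commute)

text \<open>A single term of the exponential series is at most its sum: (r |ln x|)^k / k! \<le> exp
  (r |ln x|) \<le> x^r + x^-r. Thus a logarithmic weight costs only a margin r on either side of
  \<sigma>.\<close>

lemma mellin_conv_ln_power:
  assumes [measurable]: "g \<in> borel_measurable borel"
    and "mellin_conv g (\<sigma> - r)" "mellin_conv g (\<sigma> + r)" "r > 0"
  shows "mellin_conv (\<lambda>x. ln x ^ k * g x) \<sigma>"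
proof -
  define C where "C = fact k / r ^ k"
  have C: "C > 0" using assms by (simp add: C_def)
  have sc: "mellin_conv (\<lambda>x. C * g x) \<tau>" if "mellin_conv g \<tau>" for \<tau>
  proof -
    have "set_integrable lborel {0<..} (\<lambda>x. C * (x powr (\<tau> - 1) * g x))"
      using that by (simp add: mellin_conv_def)
    then show ?thesis by (simp add: mellin_conv_def mult_ac)
  qed
  show ?thesis
  proof (rule mellin_conv_bound[OF _ sc[OF assms(2)] sc[OF assms(3)]])
    fix x :: real assume x: "x > 0"
    have "(r * \<bar>ln x\<bar>) ^ k / fact k \<le> exp (r * \<bar>ln x\<bar>)"
    proof -
      have "sum (\<lambda>n. (r * \<bar>ln x\<bar>) ^ n / fact n) {k} \<le> (\<Sum>n. (r * \<bar>ln x\<bar>) ^ n / fact n)"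
        using assms by (intro sum_le_suminf summable_exp_real) auto
      then show ?thesis by (simp add: exp_def divide_inverse mult.commute)
    qed
    also have "\<dots> \<le> x powr r + x powr (-r)" using x assms by (intro exp_abs_ln_le) auto
    finally have "\<bar>ln x\<bar> ^ k \<le> C * (x powr r + x powr (-r))"
      using assms by (simp add: C_def field_simps power_mult_distrib)
    then have "x powr (\<sigma> - 1) * \<bar>g x\<bar> * \<bar>ln x\<bar> ^ k
        \<le> x powr (\<sigma> - 1) * \<bar>g x\<bar> * (C * (x powr r + x powr (-r)))"
      by (intro mult_left_mono) auto
    also have "\<dots> = C * (x powr (\<sigma> + r - 1) * \<bar>g x\<bar>) + C * (x powr (\<sigma> - r - 1) * \<bar>g x\<bar>)"
      using x by (simp add: powr_add powr_diff powr_minus algebra_simps field_simps)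
    finally show "\<bar>x powr (\<sigma> - 1) * (ln x ^ k * g x)\<bar>
       \<le> \<bar>x powr (\<sigma> - r - 1) * (C * g x)\<bar> + \<bar>x powr (\<sigma> + r - 1) * (C * g x)\<bar>"
      using C by (simp add: abs_mult power_abs mult_ac)
  qed simp
qed

text \<open>Write x^(s-1) as \<open>x powr (s\<^sub>0 - 1)\<close> times exp ((s -
  \<open>s\<^sub>0\<close>) ln x), expand the exponential and integrate termwise. The absolute
  series sums to an exponential of |ln x|, which the convergence on both edges of the strip
  controls. Analyticity and all derivatives can be read off at once, with no differentiation under
  the integral.\<close>

lemma mellin_power_series:
  assumes [measurable]: "g \<in> borel_measurable borel"
    and "mellin_conv g (Re s\<^sub>0 - r)" "mellin_conv g (Re s\<^sub>0 + r)" "r > 0" "norm (s - s\<^sub>0) \<le> r"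
  shows "(\<lambda>k. mellin (\<lambda>x. ln x ^ k * g x) s\<^sub>0 / fact k * (s - s\<^sub>0) ^ k) sums mellin g s"
proof -
  define f where "f = (\<lambda>k x. indicator {0<..} x *\<^sub>R
      ((s - s\<^sub>0) ^ k / fact k * (of_real x powr (s\<^sub>0 - 1) * complex_of_real (ln x ^ k * g x))))"
  have conv: "mellin_conv (\<lambda>x. ln x ^ k * g x) (Re s\<^sub>0)" for k
    using assms by (intro mellin_conv_ln_power) auto
  have int: "integrable lborel (f k)" for k
  proof -
    have "set_integrable lborel {0<..} (\<lambda>x. (s - s\<^sub>0) ^ k / fact k * (of_real x powr (s\<^sub>0 - 1) * complex_of_real (ln x ^ k * g x)))"
      by (rule set_integrable_mult_right) (use conv[of k] in \<open>subst (asm) mellin_conv_iff; simp\<close>)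
    then show ?thesis by (simp add: f_def set_integrable_def)
  qed
  have intf: "integral\<^sup>L lborel (f k) = mellin (\<lambda>x. ln x ^ k * g x) s\<^sub>0 / fact k * (s - s\<^sub>0) ^ k" for k
  proof -
    have "integral\<^sup>L lborel (f k) = (LINT x:{0<..}|lborel. (s - s\<^sub>0) ^ k / fact k * (of_real x powr (s\<^sub>0 - 1) * complex_of_real (ln x ^ k * g x)))"
      unfolding set_lebesgue_integral_def f_def ..
    also have "\<dots> = (s - s\<^sub>0) ^ k / fact k * mellin (\<lambda>x. ln x ^ k * g x) s\<^sub>0"
      unfolding mellin_def by (rule set_integral_mult_right)
    finally show ?thesis by simp
  qed
  have normf: "norm (f k x) = indicator {0<..} x * (x powr (Re s\<^sub>0 - 1) * \<bar>g x\<bar>) * ((norm (s - s\<^sub>0) * \<bar>ln x\<bar>) ^ k / fact k)" for k x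
    by (auto simp: f_def indicator_def norm_mult norm_divide norm_power norm_powr_real_powr abs_mult
        power_abs power_mult_distrib)
  have normf_sums: "(\<lambda>k. norm (f k x)) sums
     (indicator {0<..} x * (x powr (Re s\<^sub>0 - 1) * \<bar>g x\<bar>) * exp (norm (s - s\<^sub>0) * \<bar>ln x\<bar>))" for x
    unfolding normf by (intro sums_mult) (use exp_converges[of "norm (s - s\<^sub>0) * \<bar>ln x\<bar>"] in \<open>simp add: divide_inverse mult.commute\<close>)
  have f_sums: "(\<lambda>k. f k x) sums (indicator {0<..} x *\<^sub>R (of_real x powr (s - 1) * complex_of_real (g x)))" for x
  proof (cases "x > 0")
    case True
    have "(\<lambda>k. (of_real x powr (s\<^sub>0 - 1) * complex_of_real (g x)) * (((s - s\<^sub>0) * of_real (ln x)) ^ k / fact k))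
       sums ((of_real x powr (s\<^sub>0 - 1) * complex_of_real (g x)) * exp ((s - s\<^sub>0) * of_real (ln x)))"
      by (intro sums_mult) (use exp_converges[of "(s - s\<^sub>0) * of_real (ln x)"] in \<open>simp add: scaleR_conv_of_real divide_inverse mult.commute\<close>)
    also have "(of_real x powr (s\<^sub>0 - 1) * complex_of_real (g x)) * exp ((s - s\<^sub>0) * of_real (ln x)) =
       of_real x powr (s - 1) * complex_of_real (g x)"
      using True by (simp add: of_real_powr_eq_exp flip: exp_add) (simp add: algebra_simps flip: exp_add)
    finally show ?thesis using True by (simp add: f_def power_mult_distrib mult_ac)
  qed (simp add: f_def)
  have bnd: "integrable lborel (\<lambda>x. indicator {0<..} x * (x powr (Re s\<^sub>0 - 1) * \<bar>g x\<bar>) * exp (norm (s - s\<^sub>0) * \<bar>ln x\<bar>))"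
  proof -
    have "set_integrable lborel {0<..} (\<lambda>x. x powr (Re s\<^sub>0 - 1) * \<bar>g x\<bar> * exp (norm (s - s\<^sub>0) * \<bar>ln x\<bar>))"
    proof (rule set_integrable_bound)
      show "set_integrable lborel {0<..} (\<lambda>x. \<bar>x powr (Re s\<^sub>0 - r - 1) * g x\<bar> + \<bar>x powr (Re s\<^sub>0 + r - 1) * g x\<bar>)"
        using assms unfolding mellin_conv_def by (intro set_integral_add set_integrable_abs)
      show "set_borel_measurable lborel {0<..} (\<lambda>x. x powr (Re s\<^sub>0 - 1) * \<bar>g x\<bar> * exp (norm (s - s\<^sub>0) * \<bar>ln x\<bar>))"
        unfolding set_borel_measurable_def by measurable
      have "norm (x powr (Re s\<^sub>0 - 1) * \<bar>g x\<bar> * exp (norm (s - s\<^sub>0) * \<bar>ln x\<bar>)) \<le>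
         norm (\<bar>x powr (Re s\<^sub>0 - r - 1) * g x\<bar> + \<bar>x powr (Re s\<^sub>0 + r - 1) * g x\<bar>)" if "x > 0" for x
      proof -
        have "exp (norm (s - s\<^sub>0) * \<bar>ln x\<bar>) \<le> exp (r * \<bar>ln x\<bar>)"
          using assms by (simp add: mult_right_mono)
        also have "\<dots> \<le> x powr r + x powr (-r)" using assms that by (intro exp_abs_ln_le) auto
        finally have "x powr (Re s\<^sub>0 - 1) * \<bar>g x\<bar> * exp (norm (s - s\<^sub>0) * \<bar>ln x\<bar>) \<le>
            x powr (Re s\<^sub>0 - 1) * \<bar>g x\<bar> * (x powr r + x powr (-r))"
          by (intro mult_left_mono) auto
        also have "\<dots> = \<bar>x powr (Re s\<^sub>0 - r - 1) * g x\<bar> + \<bar>x powr (Re s\<^sub>0 + r - 1) * g x\<bar>"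
          using that by (simp add: powr_add powr_diff powr_minus abs_mult field_simps)
        finally show ?thesis by (simp add: abs_mult)
      qed
      then show "AE x in lborel. x \<in> {0<..} \<longrightarrow> norm (x powr (Re s\<^sub>0 - 1) * \<bar>g x\<bar> * exp (norm (s - s\<^sub>0) * \<bar>ln x\<bar>)) \<le>
         norm (\<bar>x powr (Re s\<^sub>0 - r - 1) * g x\<bar> + \<bar>x powr (Re s\<^sub>0 + r - 1) * g x\<bar>)" by auto
    qed
    then show ?thesis by (simp add: set_integrable_def mult.assoc)
  qed
  \<comment> \<open>The integrals of the partial sums are bounded by the integral of the majorant in
    \<open>bnd\<close>; as the terms are non-negative, this is already summability.\<close>
  have "summable (\<lambda>k. \<integral>x. norm (f k x) \<partial>lborel)"
  proof (rule bounded_imp_summable)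
    show "0 \<le> (\<integral>x. norm (f k x) \<partial>lborel)" for k by simp
    fix n
    have "(\<Sum>k\<le>n. \<integral>x. norm (f k x) \<partial>lborel) = (\<integral>x. (\<Sum>k\<le>n. norm (f k x)) \<partial>lborel)"
      using int by (subst Bochner_Integration.integral_sum) auto
    also have "\<dots> \<le> (\<integral>x. indicator {0<..} x * (x powr (Re s\<^sub>0 - 1) * \<bar>g x\<bar>) * exp (norm (s - s\<^sub>0) * \<bar>ln x\<bar>) \<partial>lborel)"
    proof (rule integral_mono)
      show "integrable lborel (\<lambda>x. \<Sum>k\<le>n. norm (f k x))" using int by auto
      show "(\<Sum>k\<le>n. norm (f k x)) \<le> indicator {0<..} x * (x powr (Re s\<^sub>0 - 1) * \<bar>g x\<bar>) * exp (norm (s - s\<^sub>0) * \<bar>ln x\<bar>)" for x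
        using sum_le_suminf[of "\<lambda>k. norm (f k x)" "{..n}"] normf_sums[of x] by (simp add: sums_iff)
    qed (fact bnd)
    finally show "(\<Sum>k\<le>n. \<integral>x. norm (f k x) \<partial>lborel) \<le> (\<integral>x. indicator {0<..} x * (x powr (Re s\<^sub>0 - 1) * \<bar>g x\<bar>) * exp (norm (s - s\<^sub>0) * \<bar>ln x\<bar>) \<partial>lborel)" .
  qed
  from sums_integral[OF int _ this]
  have "(\<lambda>k. integral\<^sup>L lborel (f k)) sums (\<integral>x. (\<Sum>k. f k x) \<partial>lborel)"
    using normf_sums by (auto simp: sums_iff)
  moreover have "(\<integral>x. (\<Sum>k. f k x) \<partial>lborel) = mellin g s"
    using f_sums by (simp add: sums_iff mellin_def set_lebesgue_integral_def)
  ultimately show ?thesis by (simp add: intf)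
qed

lemma power_series_ball:
  fixes a :: "nat \<Rightarrow> complex"
  assumes "r > 0" and sums: "\<And>w. w \<in> ball z r \<Longrightarrow> (\<lambda>n. a n * (w - z) ^ n) sums f w"
  shows power_series_ball_holomorphic: "f holomorphic_on ball z r"
    and power_series_ball_higher_deriv: "(deriv ^^ k) f z = fact k * a k"
proof -
  show "f holomorphic_on ball z r"
    by (rule power_series_holomorphic) (use sums in auto)
  \<comment> \<open>The derivatives at 0 of a formal power series evaluated inside its disc of
    convergence are known from its coefficients; the assumed convergence on the ball bounds the
    radius below by r.\<close>
  define F where "F = Abs_fps a"
  have "conv_radius a \<ge> ereal r"
  proof (rule conv_radius_geI_ex')
    fix \<rho> assume "0 < \<rho>" "ereal \<rho> < ereal r"
    then show "summable (\<lambda>n. a n * of_real \<rho> ^ n)"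
      using sums[of "z + of_real \<rho>"] by (auto simp: dist_norm sums_iff)
  qed
  then have F: "fps_conv_radius F > 0"
    using assms(1) less_le_trans[of 0 "ereal r" "conv_radius a"]
    by (simp add: fps_conv_radius_def F_def Abs_fps_inverse)
  have "(deriv ^^ k) f z = (deriv ^^ k) (\<lambda>w. f (w + z)) 0"
    by (subst higher_deriv_shift_0) (simp add: o_def add.commute)
  also have "\<dots> = (deriv ^^ k) (eval_fps F) 0"
  proof (rule higher_deriv_cong_ev)
    have "eventually (\<lambda>w. w \<in> ball 0 r) (nhds (0::complex))"
      using assms by (intro eventually_nhds_in_open) auto
    then show "eventually (\<lambda>w. f (w + z) = eval_fps F w) (nhds 0)"
    proof eventually_elim
      case (elim w)
      then show ?case using sums[of "w + z"]
        by (simp add: eval_fps_def F_def dist_norm sums_iff)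
    qed
  qed auto
  also have "\<dots> = fact k * a k"
    using fps_nth_conv_deriv[OF F, of k] by (simp add: F_def field_simps)
  finally show "(deriv ^^ k) f z = fact k * a k" .
qed

lemma mellin_analytic:
  assumes "g \<in> borel_measurable borel" "\<And>\<sigma>. \<sigma> > a \<Longrightarrow> mellin_conv g \<sigma>" "Re s > a"
  shows mellin_analytic_at: "mellin g analytic_on {s}"
    and mellin_higher_deriv: "(deriv ^^ k) (mellin g) s = mellin (\<lambda>x. ln x ^ k * g x) s"
proof -
  \<comment> \<open>Half the distance to the line Re s = a keeps both edges of the strip of width 2r
    inside the region of convergence.\<close>
  define r where "r = (Re s - a) / 2"
  have r: "r > 0" "Re s - r > a" using assms(3) by (auto simp: r_def field_simps)
  have *: "(\<lambda>k. mellin (\<lambda>x. ln x ^ k * g x) s / fact k * (w - s) ^ k) sums mellin g w"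
    if "w \<in> ball s r" for w
    by (rule mellin_power_series) (use assms r that in \<open>auto simp: dist_norm norm_minus_commute\<close>)
  show "mellin g analytic_on {s}"
    using power_series_ball_holomorphic[OF r(1) *] r by (auto simp: analytic_at intro!: exI[of _ "ball s r"])
  show "(deriv ^^ k) (mellin g) s = mellin (\<lambda>x. ln x ^ k * g x) s"
    using power_series_ball_higher_deriv[OF r(1) *, of k] by simp
qed

section \<open>Algebra of the transform\<close>

lemma mellin_of_real:
  "mellin g (of_real \<sigma>) = of_real (LINT x:{0<..}|lborel. x powr (\<sigma> - 1) * g x)"
proof -
  have "mellin g (of_real \<sigma>) = (LINT x:{0<..}|lborel. complex_of_real (x powr (\<sigma> - 1) * g x))"
    unfolding mellin_def using powr_of_real[of _ "\<sigma> - 1"]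
    by (intro set_lebesgue_integral_cong) auto
  then show ?thesis by (simp only: set_integral_complex_of_real)
qed

lemma mellin_conv_cmult: "mellin_conv g \<sigma> \<Longrightarrow> mellin_conv (\<lambda>x. c * g x) \<sigma>"
  using set_integrable_mult_right[of c lborel "{0<..}" "\<lambda>x. x powr (\<sigma> - 1) * g x"]
  by (simp add: mellin_conv_def mult_ac)

lemma mellin_cmult: "mellin (\<lambda>x. c * g x) s = of_real c * mellin g s"
  unfolding mellin_def by (simp add: mult_ac flip: set_integral_mult_right)

lemma mellin_conv_add: "mellin_conv f \<sigma> \<Longrightarrow> mellin_conv g \<sigma> \<Longrightarrow> mellin_conv (\<lambda>x. f x + g x) \<sigma>"
  unfolding mellin_conv_def distrib_left by (rule set_integral_add)

lemma mellin_add: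
  assumes "f \<in> borel_measurable borel" "g \<in> borel_measurable borel"
    and "mellin_conv f (Re s)" "mellin_conv g (Re s)"
  shows "mellin (\<lambda>x. f x + g x) s = mellin f s + mellin g s"
  using assms unfolding mellin_def by (simp add: mellin_conv_iff distrib_left set_integral_add)

lemma mellin_conv_cong:
  "(\<And>x. x > 0 \<Longrightarrow> f x = g x) \<Longrightarrow> mellin_conv f \<sigma> \<longleftrightarrow> mellin_conv g \<sigma>"
  unfolding mellin_conv_def by (intro set_integrable_cong) auto

lemma mellin_cong: "(\<And>x. x > 0 \<Longrightarrow> f x = g x) \<Longrightarrow> mellin f s = mellin g s"
  unfolding mellin_def by (intro set_lebesgue_integral_cong) auto

lemma mellin_conv_power_mult: "mellin_conv (\<lambda>x. x ^ n * g x) \<sigma> \<longleftrightarrow> mellin_conv g (\<sigma> + real n)"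
  unfolding mellin_conv_def
  by (intro set_integrable_cong) (auto simp: powr_realpow[symmetric] powr_add powr_diff field_simps)

lemma mellin_power_mult: "mellin (\<lambda>x. x ^ n * g x) s = mellin g (s + of_nat n)"
proof -
  have "of_real x powr (s + of_nat n - 1) = of_real x powr (s - 1) * (complex_of_real x) ^ n" if "x > 0" for x
    using that powr_add[of "complex_of_real x" "s - 1" "of_nat n"]
    by (simp add: powr_nat' algebra_simps)
  then show ?thesis
    unfolding mellin_def by (intro set_lebesgue_integral_cong) (auto simp: mult_ac)
qed

section \<open>Termwise integration and monomials on a bounded interval\<close>

lemma mellin_sums:
  assumes [measurable]: "\<And>k. f k \<in> borel_measurable borel"
    and conv: "\<And>k. mellin_conv (f k) (Re s)"
    and summable: "summable (\<lambda>k. Re (mellin (\<lambda>x. \<bar>f k x\<bar>) (of_real (Re s))))"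
    and norm_summable: "\<And>x. x > 0 \<Longrightarrow> summable (\<lambda>k. \<bar>f k x\<bar>)"
    and sums: "\<And>x. x > 0 \<Longrightarrow> (\<lambda>k. f k x) sums g x"
  shows mellin_sums_conv: "mellin_conv g (Re s)"
    and mellin_sums_sums: "(\<lambda>k. mellin (f k) s) sums mellin g s"
proof -
  define u where "u = (\<lambda>k x. indicator {0<..} x *\<^sub>R (x powr (Re s - 1) * f k x))"
  define v where "v = (\<lambda>k x. indicator {0<..} x *\<^sub>R (of_real x powr (s - 1) * complex_of_real (f k x)))"
  have norm_v: "norm (v k x) = norm (u k x)" for k x
    by (auto simp: u_def v_def indicator_def norm_mult norm_powr_real_powr abs_mult)
  have u: "integrable lborel (u k)" for k
    using conv by (simp add: u_def mellin_conv_def set_integrable_def)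
  have v: "integrable lborel (v k)" for k
    using conv[of k] unfolding mellin_conv_iff[OF assms(1)] v_def set_integrable_def .
  \<comment> \<open>The norm integrals are themselves transforms, of |f k| at the real point Re s.
    The summability hypothesis is phrased this way so that the closed form known for a single term
    can be reused to check it.\<close>
  have norm_u: "(\<integral>x. norm (u k x) \<partial>lborel) = Re (mellin (\<lambda>x. \<bar>f k x\<bar>) (of_real (Re s)))" for k
    by (simp only: mellin_of_real Re_complex_of_real)
       (auto simp: set_lebesgue_integral_def u_def indicator_def abs_mult intro!: Bochner_Integration.integral_cong)
  have norm_u_summable: "summable (\<lambda>k. norm (u k x))" for x
    by (cases "x > 0") (use norm_summable in \<open>auto simp: u_def abs_mult\<close>)
  have u_sums: "(\<lambda>k. u k x) sums (indicator {0<..} x *\<^sub>R (x powr (Re s - 1) * g x))" for x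
    by (cases "x > 0") (auto simp: u_def intro!: sums_mult sums)
  have v_sums: "(\<lambda>k. v k x) sums (indicator {0<..} x *\<^sub>R (of_real x powr (s - 1) * complex_of_real (g x)))" for x
    by (cases "x > 0") (auto simp: v_def intro!: sums_mult sums_of_real sums)
  have "integrable lborel (\<lambda>x. \<Sum>k. u k x)"
    by (rule integrable_suminf[OF u]) (use norm_u_summable in simp, unfold norm_u, fact summable)
  then show "mellin_conv g (Re s)"
    using u_sums by (simp add: sums_iff mellin_conv_def set_integrable_def)
  have "(\<lambda>k. integral\<^sup>L lborel (v k)) sums (\<integral>x. (\<Sum>k. v k x) \<partial>lborel)"
    by (rule sums_integral[OF v]) (use norm_u_summable in \<open>simp add: norm_v\<close>, unfold norm_v norm_u, fact summable)
  then show "(\<lambda>k. mellin (f k) s) sums mellin g s"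
    using v_sums by (simp add: sums_iff v_def mellin_def set_lebesgue_integral_def)
qed

lemma mellin_indicator:
  assumes "\<delta> > 0" "Re s > 0"
  shows mellin_conv_indicator: "mellin_conv (indicator {..\<delta>}) (Re s)"
    and mellin_indicator_eq: "mellin (indicator {..\<delta>}) s = of_real \<delta> powr s / s"
proof -
  have "(\<lambda>t. t powr (Re s - 1)) integrable_on {0..\<delta>}"
    by (rule integrable_on_powr_from_0) (use assms in auto)
  hence "(\<lambda>t. t powr (Re s - 1)) absolutely_integrable_on {0..\<delta>}"
    by (subst absolutely_integrable_on_iff_nonneg) auto
  hence "set_integrable lborel {0..\<delta>} (\<lambda>t. t powr (Re s - 1))"
    unfolding set_integrable_def by (subst (asm) integrable_completion) auto
  hence "set_integrable lborel {0<..\<delta>} (\<lambda>t. t powr (Re s - 1))"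
    by (rule set_integrable_subset) auto
  also have "?this \<longleftrightarrow> mellin_conv (indicator {..\<delta>}) (Re s)"
    unfolding mellin_conv_def set_integrable_def
    by (intro Bochner_Integration.integrable_cong) (auto simp: indicator_def)
  finally show conv: "mellin_conv (indicator {..\<delta>}) (Re s)" .
  have eq: "indicator {0<..} x *\<^sub>R (complex_of_real x powr (s - 1) * of_real (indicator {..\<delta>} x)) =
      indicator {0<..\<delta>} x *\<^sub>R (complex_of_real x powr (s - 1))" for x
    by (auto simp: indicator_def)
  have int: "set_integrable lborel {0<..\<delta>} (\<lambda>x. complex_of_real x powr (s - 1))"
    using conv by (subst (asm) mellin_conv_iff) (simp_all add: set_integrable_def eq)
  have "mellin (indicator {..\<delta>}) s = (LINT x:{0<..\<delta>}|lborel. complex_of_real x powr (s - 1))"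
    by (simp add: mellin_def set_lebesgue_integral_def eq)
  also have "\<dots> = integral {0<..\<delta>} (\<lambda>x. complex_of_real x powr (s - 1))"
    by (rule set_borel_integral_eq_integral[OF int])
  also have "\<dots> = integral {0..\<delta>} (\<lambda>x. complex_of_real x powr (s - 1))"
    by (rule integral_spike_set) (auto intro: negligible_subset[of "{0}"])
  \<comment> \<open>The antiderivative is differentiable on the open interval and continuous at 0
    since Re s > 0; its boundary term there vanishes because \<open>0 powr s = 0\<close>.\<close>
  also have "((\<lambda>t. complex_of_real t powr (s - 1)) has_integral
            (of_real \<delta> powr s / s - of_real 0 powr s / s)) {0..\<delta>}" using assms
    by (intro fundamental_theorem_of_calculus_interior)
       (auto intro!: continuous_intros derivative_eq_intros has_vector_derivative_real_field)
  then have "integral {0..\<delta>} (\<lambda>x. complex_of_real x powr (s - 1)) = of_real \<delta> powr s / s"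
    by (simp add: integral_unique)
  finally show "mellin (indicator {..\<delta>}) s = of_real \<delta> powr s / s" .
qed

lemma mellin_power_indicator:
  assumes "\<delta> > 0" "Re s > 0"
  shows "mellin_conv (\<lambda>x. x ^ n * indicator {..\<delta>} x) (Re s)"
    and "mellin (\<lambda>x. x ^ n * indicator {..\<delta>} x) s = of_real \<delta> powr s * of_real \<delta> ^ n / (s + of_nat n)"
proof -
  show "mellin_conv (\<lambda>x. x ^ n * indicator {..\<delta>} x) (Re s)"
    using mellin_conv_indicator[of \<delta> "s + of_nat n"] assms
    by (simp add: mellin_conv_power_mult add_pos_nonneg)
  show "mellin (\<lambda>x. x ^ n * indicator {..\<delta>} x) s = of_real \<delta> powr s * of_real \<delta> ^ n / (s + of_nat n)"
    using assms mellin_indicator_eq[of \<delta> "s + of_nat n"] powr_add[of "complex_of_real \<delta>" s "of_nat n"]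
    by (simp add: mellin_power_mult add_pos_nonneg powr_nat')
qed

section \<open>Partial fraction series with poles at the non-positive integers\<close>

lemma partial_fraction_tail:
  fixes b :: "nat \<Rightarrow> complex"
  assumes "summable (\<lambda>n. norm (b n))"
  obtains H where "H holomorphic_on {s. Re s > 1 - real N}"
    "\<And>s. Re s > 1 - real N \<Longrightarrow> (\<lambda>n. b n / (s + of_nat n)) sums ((\<Sum>n<N. b n / (s + of_nat n)) + H s)"
proof -
  let ?S = "{s. Re s > 1 - real N}"
  \<comment> \<open>To the right of 1 - N every denominator from index N on has modulus at least 1.
    The tail is therefore dominated by the norms of b uniformly in s, and poles can only come from
    the first N terms.\<close>
  have nz: "norm (s + of_nat (n + N)) \<ge> 1" if "s \<in> ?S" for s n
    using that complex_Re_le_cmod[of "s + of_nat (n + N)"] by simp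
  have S: "open ?S" by (simp add: open_halfspace_Re_gt)
  have h: "summable (\<lambda>n. norm (b (n + N)))" using assms by (subst summable_iff_shift)
  have d: "((\<lambda>s. b (n + N) / (s + of_nat (n + N))) has_field_derivative
      - b (n + N) / (s + of_nat (n + N))\<^sup>2) (at s)" if "s \<in> ?S" for n s
  proof -
    have "s + of_nat (n + N) \<noteq> 0" using nz[OF that, of n] by (metis norm_zero not_one_le_zero)
    then show ?thesis
      by (auto intro!: derivative_eq_intros simp: power2_eq_square)
  qed
  have le: "\<forall>\<^sub>F n in sequentially. \<forall>s\<in>?S. norm (b (n + N) / (s + of_nat (n + N))) \<le> norm (b (n + N))"
  proof (intro always_eventually allI ballI)
    fix n s assume "s \<in> ?S"
    then have "norm (b (n + N)) / norm (s + of_nat (n + N)) \<le> norm (b (n + N)) / 1"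
      by (intro divide_left_mono nz) (use nz[of s n] in auto)
    then show "norm (b (n + N) / (s + of_nat (n + N))) \<le> norm (b (n + N))"
      by (simp add: norm_divide)
  qed
  obtain H H' where H: "\<forall>s\<in>?S. (\<lambda>n. b (n + N) / (s + of_nat (n + N))) sums H s \<and>
      (\<lambda>n. - b (n + N) / (s + of_nat (n + N))\<^sup>2) sums H' s \<and> (H has_field_derivative H' s) (at s)"
    using series_and_derivative_comparison[OF S h d le] by blast
  show ?thesis
  proof (rule that)
    show "H holomorphic_on ?S"
      using H S by (auto simp: holomorphic_on_open)
    show "(\<lambda>n. b n / (s + of_nat n)) sums ((\<Sum>n<N. b n / (s + of_nat n)) + H s)" if "Re s > 1 - real N" for s
      using H that sums_iff_shift[of "\<lambda>n. b n / (s + of_nat n)" N "H s"] by (auto simp: add_ac)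
  qed
qed

lemma partial_fraction_series:
  fixes b :: "nat \<Rightarrow> complex"
  assumes "summable (\<lambda>n. norm (b n))"
  defines "S \<equiv> (\<lambda>s. \<Sum>n. b n / (s + of_nat n))"
  shows partial_fraction_series_analytic: "s \<notin> \<int>\<^sub>\<le>\<^sub>0 \<Longrightarrow> S analytic_on {s}"
    and partial_fraction_series_meromorphic: "S meromorphic_on UNIV"
    and partial_fraction_series_residue: "(\<lambda>s. (s + of_nat m) * S s) \<midarrow>(- of_nat m)\<rightarrow> b m"
proof -
  have *: "\<exists>A H. open A \<and> z \<in> A \<and> H holomorphic_on A \<and> (\<forall>s\<in>A. S s = (\<Sum>n<N. b n / (s + of_nat n)) + H s)"
    if "Re z > 1 - real N" for z N
  proof -
    obtain H where "H holomorphic_on {s. Re s > 1 - real N}"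
      "\<And>s. Re s > 1 - real N \<Longrightarrow> (\<lambda>n. b n / (s + of_nat n)) sums ((\<Sum>n<N. b n / (s + of_nat n)) + H s)"
      using partial_fraction_tail[OF assms(1)] by blast
    then show ?thesis
      by (intro exI[of _ "{s. Re s > 1 - real N}"] exI[of _ H])
         (use that in \<open>auto simp: open_halfspace_Re_gt S_def sums_iff\<close>)
  qed
  have ex: "\<exists>N. Re z > 1 - real N" for z
    using reals_Archimedean2[of "1 - Re z"] by (auto simp: algebra_simps)
  show "S analytic_on {s}" if "s \<notin> \<int>\<^sub>\<le>\<^sub>0"
  proof -
    obtain N where N: "Re s > 1 - real N" using ex by blast
    obtain A H where A: "open A" "s \<in> A" "H holomorphic_on A" "\<And>s. s \<in> A \<Longrightarrow> S s = (\<Sum>n<N. b n / (s + of_nat n)) + H s"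
      using *[OF N] by metis
    have "(\<lambda>s. (\<Sum>n<N. b n / (s + of_nat n)) + H s) analytic_on {s}"
      using A that
      by (intro analytic_intros) (auto simp: analytic_at add_eq_0_iff2 intro: minus_of_nat_in_nonpos_Ints)
    moreover have "eventually (\<lambda>s. S s = (\<Sum>n<N. b n / (s + of_nat n)) + H s) (nhds s)"
      using eventually_nhds_in_open[OF A(1,2)] by eventually_elim (use A in auto)
    ultimately show ?thesis by (subst analytic_at_cong) auto
  qed
  show "S meromorphic_on UNIV"
    unfolding meromorphic_on_meromorphic_at[of S UNIV]
  proof
    fix z
    obtain N where N: "Re z > 1 - real N" using ex by blast
    obtain A H where A: "open A" "z \<in> A" "H holomorphic_on A" "\<And>s. s \<in> A \<Longrightarrow> S s = (\<Sum>n<N. b n / (s + of_nat n)) + H s"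
      using *[OF N] by metis
    have "H analytic_on {z}" using A by (auto simp: analytic_at)
    then have "(\<lambda>s. (\<Sum>n<N. b n / (s + of_nat n)) + H s) meromorphic_on {z}"
      by (intro meromorphic_intros analytic_on_imp_meromorphic_on[of H]) auto
    moreover have "eventually (\<lambda>s. S s = (\<Sum>n<N. b n / (s + of_nat n)) + H s) (at z)"
      using eventually_nhds_in_open[OF A(1,2)] unfolding eventually_at_filter by eventually_elim (use A in auto)
    ultimately show "S meromorphic_on {z}" by (subst meromorphic_on_cong) auto
  qed
  show "(\<lambda>s. (s + of_nat m) * S s) \<midarrow>(- of_nat m)\<rightarrow> b m"
  proof -
    \<comment> \<open>The least N for which -m lies in the open half-plane Re s > 1 - N; the term
      with index m is then among the split-off ones.\<close>
    let ?N = "m + 2" and ?z = "- of_nat m :: complex"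
    obtain A H where A: "open A" "?z \<in> A" "H holomorphic_on A" "\<And>s. s \<in> A \<Longrightarrow> S s = (\<Sum>n<?N. b n / (s + of_nat n)) + H s"
      using *[of ?N ?z] by auto
    have "isCont H ?z"
      using A by (metis holomorphic_on_imp_continuous_on continuous_on_eq_continuous_at)
    then have H: "H \<midarrow>?z\<rightarrow> H ?z" by (simp add: isCont_def)
    \<comment> \<open>For index m the product is replaced by the constant b m, its value away from
      the pole (at the pole itself division by 0 would give 0). Every summand then has an obvious
      limit.\<close>
    have t: "(\<lambda>s. if n = m then b m else (s + of_nat m) * (b n / (s + of_nat n))) \<midarrow>?z\<rightarrow> (if n = m then b m else 0)" for n
    proof (cases "n = m")
      case False
      then have "(of_nat n :: complex) - of_nat m \<noteq> 0" by simp
      then have "(\<lambda>s. (s + of_nat m) * (b n / (s + of_nat n))) \<midarrow>?z\<rightarrow> (?z + of_nat m) * (b n / (?z + of_nat n))"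
        by (intro tendsto_intros) auto
      then show ?thesis using False by simp
    qed auto
    have "(\<lambda>s. (\<Sum>n<?N. if n = m then b m else (s + of_nat m) * (b n / (s + of_nat n))) + (s + of_nat m) * H s)
      \<midarrow>?z\<rightarrow> (\<Sum>n<?N. if n = m then b m else 0) + (?z + of_nat m) * H ?z"
      by (intro tendsto_intros t H)
    also have "(\<Sum>n<?N. if n = m then b m else 0) + (?z + of_nat m) * H ?z = b m"
      by (simp add: sum.delta)
    also have "eventually (\<lambda>s. (\<Sum>n<?N. if n = m then b m else (s + of_nat m) * (b n / (s + of_nat n))) + (s + of_nat m) * H s
       = (s + of_nat m) * S s) (at ?z)"
      using eventually_at_in_open[OF A(1,2)]
    proof eventually_elim
      case (elim s)
      then have "s + of_nat m \<noteq> 0" by (auto simp: add_eq_0_iff2)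
      then have "(\<Sum>n<?N. if n = m then b m else (s + of_nat m) * (b n / (s + of_nat n))) =
           (\<Sum>n<?N. (s + of_nat m) * (b n / (s + of_nat n)))"
        by (intro sum.cong) auto
      also have "\<dots> + (s + of_nat m) * H s = (s + of_nat m) * S s"
        using elim A(4)[of s] by (simp only: sum_distrib_left distrib_left DiffD1)
      finally show ?case .
    qed
    then have "(\<lambda>s. (\<Sum>n<?N. if n = m then b m else (s + of_nat m) * (b n / (s + of_nat n))) + (s + of_nat m) * H s)
      \<midarrow>?z\<rightarrow> b m \<longleftrightarrow> ?thesis"
      by (intro tendsto_cong)
    finally show ?thesis .
  qed
qed

section \<open>Continuation beyond the half-plane of convergence\<close>

lemma mellin_conv_tail:
  assumes [measurable]: "g \<in> borel_measurable borel"
    and "\<delta> > 0" and conv: "\<And>\<sigma>. \<sigma> > 1 \<Longrightarrow> mellin_conv g \<sigma>"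
  shows "mellin_conv (\<lambda>x. g x * indicator {\<delta><..} x) \<rho>"
proof -
  \<comment> \<open>Any exponent above 1 and not below \<rho> would do. Beyond \<delta> the factor
    x^(\<rho> - \<tau>) is at most \<delta>^(\<rho> - \<tau>), so convergence at \<tau> implies
    convergence at \<rho>; the tail of the integral is thus entire in s.\<close>
  define \<tau> where "\<tau> = max \<rho> 2"
  have conv': "mellin_conv (\<lambda>x. \<delta> powr (\<rho> - \<tau>) * g x) \<tau>"
    by (intro mellin_conv_cmult conv) (simp add: \<tau>_def)
  show ?thesis
  proof (rule mellin_conv_bound[OF _ conv' conv'])
    fix x :: real assume "x > 0"
    show "\<bar>x powr (\<rho> - 1) * (g x * indicator {\<delta><..} x)\<bar>
       \<le> \<bar>x powr (\<tau> - 1) * (\<delta> powr (\<rho> - \<tau>) * g x)\<bar> + \<bar>x powr (\<tau> - 1) * (\<delta> powr (\<rho> - \<tau>) * g x)\<bar>"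
    proof (cases "x > \<delta>")
      case True
      have "x powr (\<rho> - \<tau>) \<le> \<delta> powr (\<rho> - \<tau>)"
        using True assms by (intro powr_mono2') (auto simp: \<tau>_def)
      then have "x powr (\<tau> - 1) * x powr (\<rho> - \<tau>) * \<bar>g x\<bar> \<le> x powr (\<tau> - 1) * \<delta> powr (\<rho> - \<tau>) * \<bar>g x\<bar>"
        by (intro mult_right_mono mult_left_mono) auto
      then have "\<bar>x powr (\<rho> - 1) * g x\<bar> \<le> \<bar>x powr (\<tau> - 1) * (\<delta> powr (\<rho> - \<tau>) * g x)\<bar>"
        by (simp add: abs_mult mult_ac flip: powr_add)
      then show ?thesis using True by simp
    qed auto
  qed simp
qed

text \<open>Boundedness of g near 0 improves the assumed convergence for \<sigma> > 1 to \<sigma> >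
  0. At the poles only the existence of the limit is recorded, which is enough to cancel them
  against zeros of \<open>rGamma\<close>; the value at 0 is kept because it becomes the residue of
  \<open>zeta\<close> at 1.\<close>

lemma mellin_continuation:
  assumes [measurable]: "g \<in> borel_measurable borel"
    and r: "r > 0" and h: "h holomorphic_on ball 0 r"
    and gh: "\<And>x. 0 < x \<Longrightarrow> x < r \<Longrightarrow> h (of_real x) = complex_of_real (g x)"
    and conv: "\<And>\<sigma>. \<sigma> > 1 \<Longrightarrow> mellin_conv g \<sigma>"
  obtains G where "G meromorphic_on UNIV" "\<And>s. Re s > 0 \<Longrightarrow> mellin_conv g (Re s)"
    "\<And>s. Re s > 0 \<Longrightarrow> G s = mellin g s" "\<And>s. s \<notin> \<int>\<^sub>\<le>\<^sub>0 \<Longrightarrow> G analytic_on {s}"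
    "\<And>m. \<exists>c. (\<lambda>s. (s + of_nat m) * G s) \<midarrow>(- of_nat m)\<rightarrow> c"
    "(\<lambda>s. s * G s) \<midarrow>0\<rightarrow> of_real (Re (h 0))"
proof -
  define \<delta> where "\<delta> = r / 2"
  have \<delta>: "\<delta> > 0" "\<delta> < r" using r by (auto simp: \<delta>_def)
  define a where "a = (\<lambda>n. (deriv ^^ n) h 0 / fact n)"
  \<comment> \<open>As g is real, the real parts of the Taylor coefficients already sum to g on (0,
    \<delta>], so the coefficients themselves need not be shown to be real. The factor \<delta>^n
    stems from the integral of x^(s-1+n) over (0, \<delta>].\<close>
  define b where "b = (\<lambda>n. complex_of_real (Re (a n) * \<delta> ^ n))"
  define f where "f = (\<lambda>n x. Re (a n) * (x ^ n * indicator {..\<delta>} x))"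
  define g0 where "g0 = (\<lambda>x. g x * indicator {..\<delta>} x)"
  define g1 where "g1 = (\<lambda>x. g x * indicator {\<delta><..} x)"
  define S where "S = (\<lambda>s. \<Sum>n. b n / (s + of_nat n))"
  define G where "G = (\<lambda>s. of_real \<delta> powr s * S s + mellin g1 s)"
  have [measurable]: "g0 \<in> borel_measurable borel" "g1 \<in> borel_measurable borel" "f n \<in> borel_measurable borel" for n
    unfolding g0_def g1_def f_def by measurable
  have h_sums: "(\<lambda>n. a n * z ^ n) sums h z" if "norm z < r" for z
    using holomorphic_power_series[OF h, of z] that by (simp add: a_def)
  have sm: "summable (\<lambda>n. norm (a n) * \<delta> ^ n)"
  proof -
    \<comment> \<open>An auxiliary point strictly between \<delta> = r/2 and r: convergence there
      yields absolute convergence at \<delta>.\<close>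
    have "norm (complex_of_real (3 * r / 4)) = 3 * r / 4" using r by (subst norm_of_real) auto
    then have "summable (\<lambda>n. a n * complex_of_real (3 * r / 4) ^ n)"
      using h_sums[of "of_real (3 * r / 4)"] r by (auto simp: sums_iff)
    then have "summable (\<lambda>n. norm (a n * complex_of_real \<delta> ^ n))"
      by (rule powser_insidea) (use r in \<open>auto simp: \<delta>_def norm_divide norm_mult\<close>)
    then show ?thesis using \<delta> by (simp add: norm_mult norm_power)
  qed
  have sm_b: "summable (\<lambda>n. norm (b n))"
  proof (rule summable_comparison_test'[OF sm])
    show "norm (norm (b n)) \<le> norm (a n) * \<delta> ^ n" for n
      using \<delta> abs_Re_le_cmod[of "a n"] by (simp add: b_def norm_mult norm_power mult_right_mono)
  qed
  have g1: "mellin_conv g1 \<rho>" for \<rho>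
    unfolding g1_def by (rule mellin_conv_tail) (use \<delta> conv in auto)
  have g0: "mellin_conv g0 (Re s) \<and> mellin g0 s = of_real \<delta> powr s * S s" if s: "Re s > 0" for s
  proof -
    have f_conv: "mellin_conv (f n) (Re s)" for n
      unfolding f_def using mellin_power_indicator[OF \<delta>(1) s] by (intro mellin_conv_cmult)
    have f_mellin: "mellin (f n) s = of_real \<delta> powr s * (b n / (s + of_nat n))" for n
      unfolding f_def using mellin_power_indicator[OF \<delta>(1) s] by (simp add: mellin_cmult b_def)
    have abs_f: "mellin (\<lambda>x. \<bar>f n x\<bar>) (of_real (Re s)) = of_real (\<bar>Re (a n)\<bar> * (\<delta> powr Re s * \<delta> ^ n / (Re s + real n)))" for n
    proof -
      have "mellin (\<lambda>x. \<bar>f n x\<bar>) (of_real (Re s)) = mellin (\<lambda>x. \<bar>Re (a n)\<bar> * (x ^ n * indicator {..\<delta>} x)) (of_real (Re s))"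
        by (rule mellin_cong) (simp add: f_def abs_mult)
      also have "\<dots> = of_real \<bar>Re (a n)\<bar> * (of_real \<delta> powr of_real (Re s) * of_real \<delta> ^ n / (of_real (Re s) + of_nat n))"
        using mellin_power_indicator(2)[OF \<delta>(1), of "of_real (Re s)" n] s by (simp only: mellin_cmult) simp
      finally show ?thesis using \<delta> by (simp add: powr_of_real)
    qed
    have sm_f: "summable (\<lambda>n. Re (mellin (\<lambda>x. \<bar>f n x\<bar>) (of_real (Re s))))"
    proof (rule summable_comparison_test'[of "\<lambda>n. \<delta> powr Re s / Re s * (norm (a n) * \<delta> ^ n)" 0])
      fix n
      have "\<bar>Re (a n)\<bar> * (\<delta> powr Re s * \<delta> ^ n / (Re s + real n)) \<le> norm (a n) * (\<delta> powr Re s * \<delta> ^ n / Re s)"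
        using s \<delta> by (intro mult_mono divide_left_mono abs_Re_le_cmod) auto
      then show "norm (Re (mellin (\<lambda>x. \<bar>f n x\<bar>) (of_real (Re s)))) \<le> \<delta> powr Re s / Re s * (norm (a n) * \<delta> ^ n)"
        using s \<delta> by (simp only: abs_f Re_complex_of_real) (simp add: mult_ac)
    qed (use sm in \<open>intro summable_mult\<close>)
    have f_norm: "summable (\<lambda>n. \<bar>f n x\<bar>)" if "x > 0" for x
    proof (cases "x \<le> \<delta>")
      case True
      show ?thesis
      proof (rule summable_comparison_test'[OF sm])
        show "norm \<bar>f n x\<bar> \<le> norm (a n) * \<delta> ^ n" for n
          using that True \<delta> by (auto simp: f_def abs_mult intro!: mult_mono abs_Re_le_cmod power_mono)
      qed
    qed (simp add: f_def)
    have f_sums: "(\<lambda>n. f n x) sums g0 x" if "x > 0" for x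
    proof (cases "x \<le> \<delta>")
      case True
      then have "(\<lambda>n. Re (a n * of_real x ^ n)) sums Re (h (of_real x))"
        using that \<delta> by (intro sums_Re h_sums) auto
      then show ?thesis using True that \<delta> gh[of x] by (simp add: f_def g0_def flip: of_real_power)
    qed (simp add: f_def g0_def)
    note ms = mellin_sums[where f = f and g = g0 and s = s, OF _ f_conv sm_f f_norm f_sums]
    have "(\<lambda>n. of_real \<delta> powr s * (b n / (s + of_nat n))) sums mellin g0 s"
      using ms(2) by (simp add: f_mellin)
    moreover have "(\<lambda>n. b n / (s + of_nat n)) sums S s"
      using partial_fraction_tail[OF sm_b, of 1] s unfolding S_def
      by (metis diff_self of_nat_1 sums_summable summable_sums)
    then have "(\<lambda>n. of_real \<delta> powr s * (b n / (s + of_nat n))) sums (of_real \<delta> powr s * S s)"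
      by (rule sums_mult)
    ultimately show ?thesis using ms(1) by (auto simp: sums_iff)
  qed
  have g_split: "g x = g0 x + g1 x" for x by (simp add: g0_def g1_def indicator_def)
  have g_conv: "mellin_conv g (Re s)" if "Re s > 0" for s
    using mellin_conv_add[of g0 "Re s" g1] g0[OF that] g1 by (simp flip: g_split)
  have G_eq: "G s = mellin g s" if "Re s > 0" for s
    using mellin_add[of g0 g1 s] g0[OF that] g1[of "Re s"] by (simp add: G_def flip: g_split)
  have E: "mellin g1 analytic_on {s}" for s
    by (rule mellin_analytic_at[of _ "Re s - 1"]) (use g1 in auto)
  have P: "(\<lambda>s. of_real \<delta> powr s) analytic_on {s}" for s
    using \<delta> by (auto intro!: analytic_intros)
  note S = partial_fraction_series[OF sm_b, folded S_def]
  have "G meromorphic_on UNIV"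
    unfolding G_def using E P S(2)
    by (intro meromorphic_intros) (auto intro!: analytic_on_imp_meromorphic_on simp: analytic_on_analytic_at[of _ UNIV])
  moreover have "G analytic_on {s}" if "s \<notin> \<int>\<^sub>\<le>\<^sub>0" for s
    unfolding G_def using E P S(1)[OF that] by (intro analytic_on_add analytic_on_mult)
  moreover have lim: "(\<lambda>s. (s + of_nat m) * G s) \<midarrow>(- of_nat m)\<rightarrow> of_real \<delta> powr (- of_nat m) * b m" for m
  proof -
    let ?z = "- of_nat m :: complex"
    have lims: "mellin g1 \<midarrow>?z\<rightarrow> mellin g1 ?z" "(\<lambda>s. of_real \<delta> powr s) \<midarrow>?z\<rightarrow> of_real \<delta> powr ?z"
      using analytic_at_imp_isCont[OF E] analytic_at_imp_isCont[OF P] by (simp_all only: isCont_def)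
    have "(\<lambda>s. of_real \<delta> powr s * ((s + of_nat m) * S s)) \<midarrow>?z\<rightarrow> of_real \<delta> powr ?z * b m"
      by (rule tendsto_mult) (rule lims, unfold S_def, rule partial_fraction_series_residue[OF sm_b])
    moreover have "(\<lambda>s. (s + of_nat m) * mellin g1 s) \<midarrow>?z\<rightarrow> (?z + of_nat m) * mellin g1 ?z"
      by (intro tendsto_intros lims(1))
    ultimately have "(\<lambda>s. of_real \<delta> powr s * ((s + of_nat m) * S s) + (s + of_nat m) * mellin g1 s)
        \<midarrow>?z\<rightarrow> of_real \<delta> powr ?z * b m + (?z + of_nat m) * mellin g1 ?z"
      by (rule tendsto_add)
    then show ?thesis by (simp add: G_def algebra_simps)
  qed
  moreover have "(\<lambda>s. s * G s) \<midarrow>0\<rightarrow> of_real (Re (h 0))"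
    using lim[of 0] \<delta> by (simp add: b_def a_def)
  ultimately show ?thesis using that g_conv G_eq by blast
qed

section \<open>Dirichlet series as Mellin transforms\<close>

lemma mellin_exp:
  assumes c: "c > 0" and s: "Re s > 0"
  shows mellin_conv_exp: "mellin_conv (\<lambda>x. exp (- (c * x))) (Re s)"
    and mellin_exp_eq: "mellin (\<lambda>x. exp (- (c * x))) s = Gamma s / of_real c powr s"
proof -
  define F where "F = (\<lambda>x. indicator {0<..} x *\<^sub>R (complex_of_real x powr (s - 1) * of_real (exp (- x))))"
  have "(\<lambda>t. complex_of_real t powr (s - 1) / of_real (exp t)) absolutely_integrable_on {0<..}"
    by (rule absolutely_integrable_Gamma_integral'[OF s])
  also have "(\<lambda>t. complex_of_real t powr (s - 1) / of_real (exp t)) = (\<lambda>t. complex_of_real t powr (s - 1) * of_real (exp (- t)))"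
    by (simp add: exp_minus field_simps)
  finally have int1: "set_integrable lborel {0<..} (\<lambda>t. complex_of_real t powr (s - 1) * of_real (exp (- t)))"
    unfolding set_integrable_def by (subst (asm) integrable_completion) auto
  have "integral\<^sup>L lborel F = integral {0<..} (\<lambda>t. complex_of_real t powr (s - 1) * of_real (exp (- t)))"
    using set_borel_integral_eq_integral(2)[OF int1] by (simp add: F_def set_lebesgue_integral_def)
  also have "\<dots> = Gamma s"
    using Gamma_integral_complex'[OF s] by (simp add: integral_unique exp_minus field_simps)
  finally have F: "integral\<^sup>L lborel F = Gamma s" .
  have F': "integrable lborel F" using int1 by (simp add: F_def set_integrable_def)
  \<comment> \<open>The substitution x -> c x in Euler's integral: the integrand contributes
    c^(s-1), and the Jacobian the remaining factor c.\<close>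
  have Fc: "F (c * x) = of_real c powr (s - 1) * (indicator {0<..} x *\<^sub>R (complex_of_real x powr (s - 1) * of_real (exp (- (c * x)))))" for x
    using c by (auto simp: F_def indicator_def zero_less_mult_iff powr_times_real)
  have "integrable lborel (\<lambda>x. F (0 + c * x))"
    using c by (intro lborel_integrable_real_affine F') auto
  then show "mellin_conv (\<lambda>x. exp (- (c * x))) (Re s)"
    using c set_integrable_mult_right_iff[of "of_real c powr (s - 1)" lborel "{0<..}"
        "\<lambda>x. complex_of_real x powr (s - 1) * of_real (exp (- (c * x)))"]
    by (subst mellin_conv_iff) (simp_all add: Fc set_integrable_def)
  have "integral\<^sup>L lborel F = c *\<^sub>R integral\<^sup>L lborel (\<lambda>x. F (0 + c * x))"
    using c lborel_integral_real_affine[of c F 0] by simp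
  also have "integral\<^sup>L lborel (\<lambda>x. F (0 + c * x)) = of_real c powr (s - 1) * mellin (\<lambda>x. exp (- (c * x))) s"
    by (simp add: Fc mellin_def set_lebesgue_integral_def mult_scaleR_right flip: integral_mult_right_zero)
  finally show "mellin (\<lambda>x. exp (- (c * x))) s = Gamma s / of_real c powr s"
    using c by (simp add: F powr_diff scaleR_conv_of_real field_simps)
qed

text \<open>A power series in e^-x turns into a Dirichlet series because the transform of
  e^(-(n+1)x) is Gamma(s)/(n+1)^s. Non-negative coefficients make the norm integrals the same series
  at Re s, so its convergence justifies the interchange.\<close>

lemma dirichlet_mellin:
  assumes c: "\<And>n. c n \<ge> 0" and s: "Re s > 0"
    and summable: "summable (\<lambda>n. c n / real (Suc n) powr Re s)"
    and sums: "\<And>x. x > 0 \<Longrightarrow> (\<lambda>n. c n * exp (- (real (Suc n) * x))) sums g x"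
  shows dirichlet_mellin_conv: "mellin_conv g (Re s)"
    and dirichlet_mellin_sums: "(\<lambda>n. of_real (c n) / of_nat (Suc n) powr s) sums (mellin g s / Gamma s)"
proof -
  define f where "f = (\<lambda>n x. c n * exp (- (real (Suc n) * x)))"
  have [measurable]: "f n \<in> borel_measurable borel" for n unfolding f_def by measurable
  have conv: "mellin_conv (f n) (Re s)" for n
    unfolding f_def using s by (intro mellin_conv_cmult mellin_conv_exp) auto
  have mell: "mellin (f n) z = of_real (c n) / of_nat (Suc n) powr z * Gamma z" if "Re z > 0" for n z
    unfolding f_def using mellin_exp_eq[of "real (Suc n)", OF _ that] by (simp only: mellin_cmult) simp
  have abs_f: "\<bar>f n x\<bar> = f n x" for n x using c by (simp add: f_def)
  have re: "Re (mellin (\<lambda>x. \<bar>f n x\<bar>) (of_real (Re s))) = c n / real (Suc n) powr Re s * Gamma (Re s)" for n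
  proof -
    have "mellin (\<lambda>x. \<bar>f n x\<bar>) (of_real (Re s)) = of_real (c n / real (Suc n) powr Re s * Gamma (Re s))"
      using mell[of "of_real (Re s)" n] s powr_of_real[of "real (Suc n)" "Re s"]
      by (simp add: abs_f Gamma_complex_of_real)
    then show ?thesis by (simp only: Re_complex_of_real)
  qed
  have "summable (\<lambda>n. Re (mellin (\<lambda>x. \<bar>f n x\<bar>) (of_real (Re s))))"
    unfolding re by (rule summable_mult2[OF summable])
  moreover have "summable (\<lambda>n. \<bar>f n x\<bar>)" if "x > 0" for x
    unfolding abs_f using sums[OF that] by (simp add: f_def sums_iff)
  ultimately have ms: "mellin_conv g (Re s)" "(\<lambda>n. mellin (f n) s) sums mellin g s"
    using mellin_sums[of f s g] conv sums by (auto simp: f_def)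
  show "mellin_conv g (Re s)" by fact
  have "Gamma s \<noteq> 0" using s by (auto simp: Gamma_eq_zero_iff elim!: nonpos_Ints_cases)
  with sums_divide[OF ms(2), of "Gamma s"] s
  show "(\<lambda>n. of_real (c n) / of_nat (Suc n) powr s) sums (mellin g s / Gamma s)"
    by (simp add: mell)
qed

subsection \<open>Generating series\<close>

lemma exp_neg_Suc_mult: "exp (- (real (Suc n) * x)) = exp (- x) ^ Suc n"
  by (simp only: exp_of_nat_mult[symmetric] mult_minus_right)

lemma geometric_exp_sums:
  assumes "x > (0::real)"
  shows "(\<lambda>n. 1 * exp (- (real (Suc n) * x))) sums (exp (- x) / (1 - exp (- x)))"
proof -
  have "(\<lambda>n. exp (- x) * exp (- x) ^ n) sums (exp (- x) * (1 / (1 - exp (- x))))"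
    using assms by (intro sums_mult geometric_sums) auto
  then show ?thesis by (simp only: exp_neg_Suc_mult) simp
qed

lemma ln_power_sums:
  assumes "\<bar>y\<bar> < (1::real)"
  shows "(\<lambda>n. 1 / real (Suc n) * y ^ Suc n) sums (- ln (1 - y))"
proof -
  have "(\<lambda>n. - ((-(-y))^n) / of_nat n) sums ln (1 + (-y))"
    using assms by (intro ln_series') auto
  from sums_minus[OF this] have "(\<lambda>n. y ^ n / of_nat n) sums (- ln (1 - y))" by simp
  \<comment> \<open>The term of index 0 is a division by 0 and hence 0, so the shift by one loses
    nothing.\<close>
  then show ?thesis using sums_Suc_iff[of "\<lambda>n. y ^ n / real n" "- ln (1 - y)"] by simp
qed

lemma ln_exp_sums:
  assumes "x > (0::real)"
  shows "(\<lambda>n. 1 / real (Suc n) * exp (- (real (Suc n) * x))) sums (- ln (1 - exp (- x)))"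
  using ln_power_sums[of "exp (- x)"] assms by (simp only: exp_neg_Suc_mult) simp

text \<open>Dividing by 1 - y replaces the coefficients of a power series by their partial sums, and
  the partial sums of the coefficients 1/(n+1) of -ln(1 - y) are the harmonic numbers.\<close>

lemma harm_exp_sums:
  assumes "x > (0::real)"
  shows "(\<lambda>n. harm (Suc n) * exp (- (real (Suc n) * x))) sums (- ln (1 - exp (- x)) / (1 - exp (- x)))"
proof -
  define y where "y = exp (- x)"
  have y: "0 < y" "y < 1" using assms by (auto simp: y_def)
  have "summable (\<lambda>n. norm (1 / real (Suc n) * y ^ Suc n))"
    using ln_power_sums[of y] y by (auto simp: sums_iff)
  moreover have "summable (\<lambda>n. norm (y ^ n))" using y by simp
  ultimately have "(\<lambda>k. \<Sum>i\<le>k. 1 / real (Suc i) * y ^ Suc i * y ^ (k - i)) sums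
      ((\<Sum>n. 1 / real (Suc n) * y ^ Suc n) * (\<Sum>n. y ^ n))"
    by (rule Cauchy_product_sums)
  also have "(\<Sum>n. 1 / real (Suc n) * y ^ Suc n) = - ln (1 - y)"
    using ln_power_sums[of y] y by (intro sums_unique[symmetric]) simp
  also have "(\<Sum>n. y ^ n) = 1 / (1 - y)" using y by (intro suminf_geometric) auto
  also have "(\<lambda>k. \<Sum>i\<le>k. 1 / real (Suc i) * y ^ Suc i * y ^ (k - i)) = (\<lambda>k. harm (Suc k) * y ^ Suc k)"
  proof
    fix k
    have "(\<Sum>i\<le>k. 1 / real (Suc i) * y ^ Suc i * y ^ (k - i)) = (\<Sum>i\<le>k. inverse (real (Suc i)) * y ^ Suc k)"
      by (intro sum.cong) (auto simp: divide_inverse mult_ac simp flip: power_add)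
    also have "\<dots> = harm (Suc k) * y ^ Suc k"
      by (simp only: harm_altdef sum_distrib_right lessThan_Suc_atMost)
    finally show "(\<Sum>i\<le>k. 1 / real (Suc i) * y ^ Suc i * y ^ (k - i)) = harm (Suc k) * y ^ Suc k" .
  qed
  finally show ?thesis by (simp only: exp_neg_Suc_mult y_def) simp
qed

lemma summable_inverse_powr:
  assumes "\<sigma> > 1"
  shows "summable (\<lambda>n. 1 / real (Suc n) powr \<sigma>)"
proof -
  have "summable (\<lambda>n. real n powr (-\<sigma>))" using assms by (subst summable_real_powr_iff) auto
  then have "summable (\<lambda>n. real (Suc n) powr (-\<sigma>))" by (subst summable_Suc_iff)
  then show ?thesis by (simp only: powr_minus_divide)
qed

lemma summable_harm_powr:
  assumes "\<sigma> > 1"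
  shows "summable (\<lambda>n. harm (Suc n) / real (Suc n) powr \<sigma>)"
proof -
  \<comment> \<open>Half of the surplus of \<sigma> over 1 pays for the growth of the harmonic
    numbers: 1/k \<le> n^\<epsilon> / k^(1+\<epsilon>) for k \<le> n bounds them by C n^\<epsilon>,
    and the exponent \<sigma> - \<epsilon> still exceeds 1.\<close>
  define \<epsilon> where "\<epsilon> = (\<sigma> - 1) / 2"
  have \<epsilon>: "\<epsilon> > 0" "\<sigma> - \<epsilon> > 1" using assms by (auto simp: \<epsilon>_def field_simps)
  define C where "C = (\<Sum>n. 1 / real (Suc n) powr (1 + \<epsilon>))"
  have le: "harm (Suc n) \<le> C * real (Suc n) powr \<epsilon>" for n
  proof -
    have "harm (Suc n) = (\<Sum>k<Suc n. inverse (real (Suc k)))" by (simp only: harm_altdef)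
    also have "\<dots> \<le> (\<Sum>k<Suc n. 1 / real (Suc k) powr (1 + \<epsilon>) * real (Suc n) powr \<epsilon>)"
    proof (rule sum_mono)
      fix k assume "k \<in> {..<Suc n}"
      then have "real (Suc k) powr \<epsilon> \<le> real (Suc n) powr \<epsilon>" using \<epsilon> by (intro powr_mono2) auto
      then show "inverse (real (Suc k)) \<le> 1 / real (Suc k) powr (1 + \<epsilon>) * real (Suc n) powr \<epsilon>"
        by (simp add: powr_add field_simps del: of_nat_Suc)
    qed
    also have "\<dots> = (\<Sum>k<Suc n. 1 / real (Suc k) powr (1 + \<epsilon>)) * real (Suc n) powr \<epsilon>"
      by (simp only: sum_distrib_right)
    also have "\<dots> \<le> C * real (Suc n) powr \<epsilon>"
      unfolding C_def using \<epsilon>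
      by (intro mult_right_mono sum_le_suminf summable_inverse_powr) auto
    finally show ?thesis .
  qed
  show ?thesis
  proof (rule summable_comparison_test'[OF summable_mult[OF summable_inverse_powr[OF \<epsilon>(2)], of C]])
    fix n
    have "harm (Suc n) / real (Suc n) powr \<sigma> \<le> C * real (Suc n) powr \<epsilon> / real (Suc n) powr \<sigma>"
      by (intro divide_right_mono le) auto
    also have "\<dots> = C * (1 / real (Suc n) powr (\<sigma> - \<epsilon>))"
      by (simp add: powr_diff del: of_nat_Suc)
    finally show "norm (harm (Suc n) / real (Suc n) powr \<sigma>) \<le> C * (1 / real (Suc n) powr (\<sigma> - \<epsilon>))"
      by (simp add: harm_nonneg del: of_nat_Suc)
  qed
qed

subsection \<open>Meromorphic continuations and Taylor coefficients\<close>

text \<open>By the identity theorem two candidates agree near every point, except possibly at the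
  point itself. There the normalisation decides: both are 0 at a common pole, and both equal their
  common limit elsewhere.\<close>

lemma meromorphic_continuation_eqI:
  assumes g: "g nicely_meromorphic_on UNIV" and A: "open A" "A \<noteq> {}"
    and eq: "\<And>s. s \<in> A \<Longrightarrow> g s = f s"
  shows "meromorphic_continuation f A = g"
  unfolding meromorphic_continuation_def
proof (rule the_equality)
  show "g nicely_meromorphic_on UNIV \<and> (\<forall>s\<in>A. g s = f s)" using g eq by auto
next
  fix g' assume g': "g' nicely_meromorphic_on UNIV \<and> (\<forall>s\<in>A. g' s = f s)"
  \<comment> \<open>A difference of two normalised functions need not be normalised: at a common
    pole its value is 0, whereas its limit may be another number.\<close>
  define d where "d = remove_sings (\<lambda>z. g z - g' z)"
  have mero: "(\<lambda>z. g z - g' z) meromorphic_on UNIV"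
    using g g' by (auto simp: nicely_meromorphic_on_def intro!: meromorphic_intros)
  have d: "d nicely_meromorphic_on UNIV"
    unfolding d_def using mero by (rule remove_sings_nicely_meromorphic)
  have dA: "d z = 0" if "z \<in> A" for z
    unfolding d_def
  proof (rule remove_sings_eqI, rule tendsto_eventually)
    show "\<forall>\<^sub>F w in at z. g w - g' w = 0"
      using eventually_at_in_open'[OF A(1) that] by eventually_elim (use g' eq in auto)
  qed
  obtain z0 where z0: "z0 \<in> A" using A by auto
  have "\<forall>\<^sub>F z in at z0. d z = 0"
    using eventually_at_in_open'[OF A(1) z0] by eventually_elim (use dA in auto)
  then have "\<exists>\<^sub>F z in at z0. d z = 0" by (intro eventually_frequently) auto
  then have d0: "d z = 0" for z
    by (rule frequently_eq_meromorphic_imp_constant[OF _ d]) auto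
  show "g' = g"
  proof
    fix z
    have "isolated_singularity_at (\<lambda>z. g z - g' z) z"
      using mero by (meson UNIV_I meromorphic_on_isolated_singularity meromorphic_on_subset subset_UNIV)
    from eventually_remove_sings_eq_at[OF this]
    have ev: "\<forall>\<^sub>F w in at z. g w = g' w"
      by eventually_elim (use d0 in \<open>auto simp: d_def\<close>)
    then have pole: "is_pole g z \<longleftrightarrow> is_pole g' z" by (intro is_pole_cong) auto
    show "g' z = g z"
    proof (cases "is_pole g z")
      case True
      then show ?thesis using pole g g' nicely_meromorphic_onE
        by (metis UNIV_I is_pole_zero_at_nicely_mero)
    next
      case False
      then have "g \<midarrow>z\<rightarrow> g z" "g' \<midarrow>z\<rightarrow> g' z"
        using g g' pole by (auto simp: nicely_meromorphic_on_def)
      then show ?thesis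
        using tendsto_cong[OF ev] by (metis LIM_unique)
    qed
  qed
qed

lemma meromorphic_continuation_eq_remove_sings:
  assumes "R meromorphic_on UNIV" "open A" "A \<noteq> {}"
    and "\<And>s. s \<in> A \<Longrightarrow> R analytic_on {s}" "\<And>s. s \<in> A \<Longrightarrow> R s = f s"
  shows "meromorphic_continuation f A = remove_sings R"
  by (rule meromorphic_continuation_eqI) (use assms in \<open>auto intro!: remove_sings_nicely_meromorphic\<close>)

text \<open>Serves both families of constants: D is the plane without 1 in one case and a punctured
  disc in the other. Hence the radius of the ball on which f is holomorphic may depend on the point
  s.\<close>

lemma the_taylor_coeffs:
  assumes holo: "\<And>s. s \<in> D \<Longrightarrow> \<exists>r. s \<in> ball 1 r \<and> f holomorphic_on ball 1 r"
    and fg: "\<And>s. s \<in> D \<Longrightarrow> g s = f s"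
    and r: "r > 0" "ball 1 r - {1} \<subseteq> D"
  shows "(THE c. \<forall>s. s \<in> D \<longrightarrow> (\<lambda>m. (-1) ^ m * c m / fact m * (s - 1) ^ m) sums g s) =
    (\<lambda>m. (-1) ^ m * (deriv ^^ m) f (1::complex))"
proof (rule the_equality)
  have ex: "(\<lambda>m. (deriv ^^ m) f 1 / fact m * (s - 1) ^ m) sums g s" if "s \<in> D" for s
    using holomorphic_power_series holo[OF that] fg[OF that] by metis
  have cancel: "(-1) ^ m * ((-1) ^ m * z) = (z::complex)" for m z
    by (simp flip: mult.assoc power_mult_distrib)
  show "\<forall>s. s \<in> D \<longrightarrow> (\<lambda>m. (-1) ^ m * ((-1) ^ m * (deriv ^^ m) f 1) / fact m * (s - 1) ^ m) sums g s"
    using ex by (simp only: cancel) auto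
  fix c assume c: "\<forall>s. s \<in> D \<longrightarrow> (\<lambda>m. (-1) ^ m * c m / fact m * (s - 1) ^ m) sums g s"
  define d where "d = (\<lambda>m. ((-1) ^ m * c m - (deriv ^^ m) f 1) / fact m)"
  \<comment> \<open>The point 1 need not lie in D, so at w = 0 only the trivial value d 0 of the
    series is available. The sum is holomorphic and vanishes on the punctured disc, hence also at
    its centre.\<close>
  have d_sums: "(\<lambda>m. d m * (w - 0) ^ m) sums (if w = 0 then d 0 else 0)" if "w \<in> ball 0 r" for w
  proof (cases "w = 0")
    case False
    then have "1 + w \<in> D" using that r by (auto simp: dist_norm)
    from sums_diff[OF c[rule_format, OF this] ex[OF this]] False
    show ?thesis by (simp add: d_def algebra_simps diff_divide_distrib)
  qed (use powser_sums_zero[of d] in simp)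
  have "d m = 0" for m
  proof (rule ccontr)
    assume "d m \<noteq> 0"
    have H: "(\<lambda>w. if w = 0 then d 0 else 0) holomorphic_on ball 0 r"
      by (rule power_series_ball_holomorphic[OF r(1) d_sums])
    have "of_real (r / 2) \<in> ball 0 r - {0 :: complex}" using r(1) by auto
    then have ne: "ball 0 r - {0 :: complex} \<noteq> {}" by blast
    have "(if w = 0 then d 0 else 0) = 0" if "w \<in> ball 0 r" for w :: complex
      by (intro analytic_continuation_open[of "ball 0 r - {0}" "ball 0 r" "\<lambda>w. if w = 0 then d 0 else 0" "\<lambda>_. 0" w])
         (use H that ne in auto)
    then have "(deriv ^^ m) (\<lambda>w. if w = 0 then d 0 else 0) 0 = (deriv ^^ m) (\<lambda>_. 0) (0::complex)"
      by (intro higher_deriv_transform_within_open[where S = "ball 0 r"]) (use r(1) H in auto)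
    also have "(deriv ^^ m) (\<lambda>_. 0) (0::complex) = 0" by (simp add: higher_deriv_const)
    finally show False
      using power_series_ball_higher_deriv[OF r(1) d_sums, of m] \<open>d m \<noteq> 0\<close> by simp
  qed
  then have "(-1) ^ m * c m = (deriv ^^ m) f 1" for m by (simp add: d_def)
  then show "c = (\<lambda>m. (-1) ^ m * (deriv ^^ m) f 1)"
    using cancel by (metis ext)
qed

text \<open>The common factor of both kernels near 0. A positive real part keeps p away from 0, so
  that it can be divided by, and off the branch cut of \<open>Ln\<close>.\<close>

lemma one_minus_exp_quotient:
  obtains r p where "r > 0" "p holomorphic_on ball 0 r" "p (0::complex) = 1"
    "\<And>z. z \<noteq> 0 \<Longrightarrow> p z = (1 - exp (- z)) / z" "\<And>z. z \<in> ball 0 r \<Longrightarrow> Re (p z) > 0"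
proof -
  \<comment> \<open>Chosen so that f z - f 0 = 1 - e^-z: the quotient is then a difference quotient
    of an entire function and extends over 0 by its derivative.\<close>
  define f where "f = (\<lambda>z::complex. - exp (- z))"
  define p where "p = (\<lambda>z. if z = 0 then deriv f 0 else (f z - f 0) / (z - 0))"
  have "(f has_field_derivative 1) (at 0)"
    unfolding f_def by (auto intro!: derivative_eq_intros)
  then have p0: "p 0 = 1" by (simp add: p_def DERIV_imp_deriv)
  have p: "p holomorphic_on UNIV"
    unfolding p_def by (rule pole_lemma_open) (auto simp: f_def intro!: holomorphic_intros)
  then have "isCont p 0"
    using holomorphic_on_imp_continuous_on continuous_on_eq_continuous_at[of UNIV p] by auto
  then have "(\<lambda>z. Re (p z)) \<midarrow>0\<rightarrow> Re (p 0)" by (intro tendsto_intros) (simp add: isCont_def)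
  then have "\<forall>\<^sub>F z in at 0. Re (p z) > 0" by (rule order_tendstoD) (simp add: p0)
  then have "\<forall>\<^sub>F z in nhds 0. Re (p z) > 0" by (simp add: eventually_nhds_conv_at p0)
  then obtain r where "r > 0" "\<And>z. z \<in> ball 0 r \<Longrightarrow> Re (p z) > 0"
    unfolding eventually_nhds_metric by (auto simp: dist_commute)
  then show ?thesis using that[of r p] p p0 holomorphic_on_subset[OF p] by (auto simp: p_def f_def)
qed

subsection \<open>The Riemann zeta function\<close>

text \<open>The Bose-Einstein kernel 1/(e^x - 1), written as the sum of the geometric series in
  e^-x.\<close>

definition bose :: "real \<Rightarrow> real" where "bose x = exp (- x) / (1 - exp (- x))"

lemma bose_measurable [measurable]: "bose \<in> borel_measurable borel"
  unfolding bose_def by measurable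

lemma mellin_bose:
  assumes "Re s > 1"
  shows mellin_conv_bose: "mellin_conv bose (Re s)"
    and mellin_bose_sums: "(\<lambda>n. 1 / of_nat (Suc n) powr s) sums (mellin bose s / Gamma s)"
  using dirichlet_mellin[of "\<lambda>_. 1" s bose] assms summable_inverse_powr[OF assms] geometric_exp_sums
  by (simp_all add: bose_def del: of_nat_Suc)

text \<open>The kernel has a simple pole at 0, so the continuation result is applied to x times the
  kernel, which shifts the argument of the transform by one. The last limit is the value at 0 of
  e^-z / p z.\<close>

lemma mellin_bose_continuation:
  obtains G where "G meromorphic_on UNIV"
    "\<And>s. Re s > 0 \<Longrightarrow> G s = mellin bose (s + 1)" "\<And>s. s \<notin> \<int>\<^sub>\<le>\<^sub>0 \<Longrightarrow> G analytic_on {s}"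
    "\<And>m. \<exists>c. (\<lambda>s. (s + of_nat m) * G s) \<midarrow>(- of_nat m)\<rightarrow> c"
    "(\<lambda>s. s * G s) \<midarrow>0\<rightarrow> 1"
proof -
  obtain r p where p: "r > 0" "p holomorphic_on ball 0 r" "p (0::complex) = 1"
    "\<And>z. z \<noteq> 0 \<Longrightarrow> p z = (1 - exp (- z)) / z" "\<And>z. z \<in> ball 0 r \<Longrightarrow> Re (p z) > 0"
    using one_minus_exp_quotient by blast
  have nz: "p z \<noteq> 0" if "z \<in> ball 0 r" for z using p(5)[OF that] by auto
  have 1: "(\<lambda>z. exp (- z) / p z) holomorphic_on ball 0 r"
    using p(2) nz by (intro holomorphic_intros) auto
  have 2: "exp (- complex_of_real x) / p (of_real x) = of_real (x ^ 1 * bose x)" if "0 < x" for x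
  proof -
    have "1 - exp (- complex_of_real x) = of_real (1 - exp (-x))" by (simp add: exp_of_real flip: of_real_minus)
    moreover have "exp (- complex_of_real x) = of_real (exp (-x))" by (simp add: exp_of_real flip: of_real_minus)
    ultimately show ?thesis using that by (simp add: p(4) bose_def)
  qed
  have 3: "mellin_conv (\<lambda>x. x ^ 1 * bose x) \<sigma>" if "\<sigma> > 1" for \<sigma>
    unfolding mellin_conv_power_mult using mellin_conv_bose[of "of_real (\<sigma> + 1)"] that by simp
  have 4: "mellin (\<lambda>x. x * bose x) s = mellin bose (s + 1)" for s
    using mellin_power_mult[of 1 bose s] by simp
  show ?thesis
    by (rule mellin_continuation[of "\<lambda>x. x ^ 1 * bose x", OF _ p(1) 1 2 3])
       (use that p(3) in \<open>simp_all add: 4\<close>)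
qed

lemma halfplane_nonempty: "{s. Re s > 1} \<noteq> {}"
  by (auto intro: exI[of _ 2])

lemma nonpos_Ints_Re_le: "s \<in> \<int>\<^sub>\<le>\<^sub>0 \<Longrightarrow> Re s \<le> 0"
  by (auto elim!: nonpos_Ints_cases)

text \<open>The shifted continuation \<open>G (s - 1)\<close> can have poles only at 1, 0, -1, and
  so on. The zeros of \<open>rGamma\<close> at the non-positive integers remove all of them except
  the one at 1, where \<open>rGamma\<close> has the value 1 and leaves the residue
  unchanged.\<close>

lemma zeta_props:
  shows zeta_nicely_meromorphic: "zeta nicely_meromorphic_on UNIV"
    and zeta_eq_mellin: "Re s > 1 \<Longrightarrow> zeta s = mellin bose s / Gamma s"
    and zeta_analytic: "z \<noteq> 1 \<Longrightarrow> zeta analytic_on {z}"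
    and zeta_residue: "(\<lambda>s. (s - 1) * zeta s) \<midarrow>1\<rightarrow> 1"
proof -
  obtain G where G: "G meromorphic_on UNIV"
    "\<And>s. Re s > 0 \<Longrightarrow> G s = mellin bose (s + 1)" "\<And>s. s \<notin> \<int>\<^sub>\<le>\<^sub>0 \<Longrightarrow> G analytic_on {s}"
    "\<And>m. \<exists>c. (\<lambda>s. (s + of_nat m) * G s) \<midarrow>(- of_nat m)\<rightarrow> c"
    "(\<lambda>s. s * G s) \<midarrow>0\<rightarrow> 1"
    using mellin_bose_continuation by blast
  define R where "R = (\<lambda>s. rGamma s * G (s - 1))"
  have R: "R meromorphic_on UNIV"
    unfolding R_def using G(1)
    by (intro meromorphic_intros meromorphic_on_compose[OF G(1)] analytic_intros)
       (auto intro!: analytic_on_imp_meromorphic_on analytic_rGamma)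
  have R_analytic: "R analytic_on {s}" if "s - 1 \<notin> \<int>\<^sub>\<le>\<^sub>0" for s
  proof -
    have "(G \<circ> (\<lambda>s. s - 1)) analytic_on {s}"
      by (rule analytic_on_compose_gen[of _ _ _ "{s - 1}"]) (use G(3)[OF that] in \<open>auto intro!: analytic_intros\<close>)
    then show ?thesis unfolding R_def o_def by (intro analytic_on_mult analytic_rGamma)
  qed
  have R_eq: "R s = mellin bose s / Gamma s" if "Re s > 1" for s
    using that by (simp add: R_def G(2) Gamma_def field_simps)
  have zeta: "zeta = remove_sings R"
    unfolding zeta_def
  proof (rule meromorphic_continuation_eq_remove_sings[OF R _ halfplane_nonempty])
    fix s assume s: "s \<in> {s. Re s > 1}"
    show "R analytic_on {s}" using s nonpos_Ints_Re_le[of "s - 1"] by (intro R_analytic) auto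
    show "R s = (\<Sum>n. 1 / of_nat (Suc n) powr s)"
      using mellin_bose_sums[of s] s R_eq by (simp add: sums_iff)
  qed (rule open_halfspace_Re_gt)
  show "zeta nicely_meromorphic_on UNIV"
    unfolding zeta by (rule remove_sings_nicely_meromorphic[OF R])
  show "zeta s = mellin bose s / Gamma s" if "Re s > 1" for s
    using that nonpos_Ints_Re_le[of "s - 1"] remove_sings_at_analytic[OF R_analytic[of s]]
    by (auto simp: zeta R_eq)
  have iso: "isolated_singularity_at R s" for s
    using R by (meson UNIV_I meromorphic_on_isolated_singularity meromorphic_on_subset subset_UNIV)
  have shift: "(\<lambda>s. (s - z) * G (s - 1)) \<midarrow>z\<rightarrow> c"
    if "(\<lambda>s. (s + of_nat m) * G s) \<midarrow>(- of_nat m)\<rightarrow> c" "z = 1 - of_nat m" for z m c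
  proof -
    have "((\<lambda>s. s - 1) \<longlongrightarrow> z - 1) (at z)" by (intro tendsto_intros)
    moreover have "\<forall>\<^sub>F s in at z. s - 1 \<noteq> z - 1" by (auto simp: eventually_at_filter)
    ultimately have "filterlim (\<lambda>s. s - 1) (at (z - 1)) (at z)" by (simp add: filterlim_at)
    moreover have "z - 1 = - of_nat m" using that by simp
    ultimately have "((\<lambda>s. (s - 1 + of_nat m) * G (s - 1)) \<longlongrightarrow> c) (at z)"
      using filterlim_compose[OF that(1)] by metis
    moreover have "s - 1 + of_nat m = s - z" for s using that(2) by simp
    ultimately show ?thesis by simp
  qed
  show "zeta analytic_on {z}" if "z \<noteq> 1" for z
  proof (cases "z - 1 \<in> \<int>\<^sub>\<le>\<^sub>0")
    case False
    then show ?thesis unfolding zeta by (intro remove_sings_analytic_on R_analytic)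
  next
    case True
    then obtain m where m: "z - 1 = - of_nat m" by (auto elim!: nonpos_Ints_cases')
    then have z: "z = 1 - of_nat m" by (simp add: algebra_simps)
    with that have "m \<ge> 1" by (cases m) auto
    then have "z = - of_nat (m - 1)" using z by (simp add: of_nat_diff)
    then have "rGamma z = 0" by (auto simp: rGamma_eq_zero_iff)
    moreover have "(rGamma has_field_derivative deriv rGamma z) (at z)"
      by (simp add: DERIV_deriv_iff_field_differentiable field_differentiable_rGamma)
    \<comment> \<open>As \<open>rGamma\<close> vanishes at z, this quotient is its difference
      quotient. Multiplied by the finite limit of (s - z) G(s - 1) it shows that the product R has a
      finite limit at z.\<close>
    ultimately have d: "(\<lambda>s. rGamma s / (s - z)) \<midarrow>z\<rightarrow> deriv rGamma z"
      by (simp add: has_field_derivative_iff)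
    obtain c where "(\<lambda>s. (s + of_nat m) * G s) \<midarrow>(- of_nat m)\<rightarrow> c" using G(4) by blast
    from tendsto_mult[OF d shift[OF this z]]
    have "(\<lambda>s. rGamma s / (s - z) * ((s - z) * G (s - 1))) \<midarrow>z\<rightarrow> deriv rGamma z * c" .
    moreover have "\<forall>\<^sub>F s in at z. rGamma s / (s - z) * ((s - z) * G (s - 1)) = R s"
      unfolding eventually_at_filter R_def by (intro always_eventually) auto
    ultimately have "R \<midarrow>z\<rightarrow> deriv rGamma z * c" by (rule Lim_transform_eventually)
    then show ?thesis unfolding zeta by (rule remove_sings_analytic_at[OF iso])
  qed
  show "(\<lambda>s. (s - 1) * zeta s) \<midarrow>1\<rightarrow> 1"
  proof -
    have "isCont rGamma (1::complex)" by (rule analytic_at_imp_isCont[OF analytic_rGamma])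
    then have "rGamma \<midarrow>1\<rightarrow> (1::complex)" by (simp add: isCont_def)
    from tendsto_mult[OF this shift[of 0 1 1]]
    have "(\<lambda>s. rGamma s * ((s - 1) * G (s - 1))) \<midarrow>1\<rightarrow> 1" using G(5) by simp
    moreover have "\<forall>\<^sub>F s in at 1. rGamma s * ((s - 1) * G (s - 1)) = (s - 1) * zeta s"
      using eventually_remove_sings_eq_at[OF iso[of 1]] by eventually_elim (simp add: zeta R_def)
    ultimately show ?thesis by (rule Lim_transform_eventually)
  qed
qed

lemma zeta_sums: "Re s > 1 \<Longrightarrow> (\<lambda>n. 1 / of_nat (Suc n) powr s) sums zeta s"
  using mellin_bose_sums zeta_eq_mellin by simp

lemma zeta_regular_part:
  obtains Z where "Z holomorphic_on UNIV" "\<And>s. s \<noteq> 1 \<Longrightarrow> zeta s = 1 / (s - 1) + Z s"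
proof -
  define E where "E = remove_sings (\<lambda>s. (s - 1) * zeta s)"
  have A: "(\<lambda>s. (s - 1) * zeta s) analytic_on {z}" if "z \<noteq> 1" for z
    using zeta_analytic[OF that] by (intro analytic_intros)
  have iso: "isolated_singularity_at (\<lambda>s. (s - 1) * zeta s) 1"
    using A unfolding isolated_singularity_at_def
    by (intro exI[of _ 1]) (auto simp: analytic_on_analytic_at[of _ "ball 1 1 - {1}"])
  have "E analytic_on {z}" for z
    unfolding E_def using A[of z] remove_sings_analytic_at[OF iso zeta_residue]
    by (cases "z = 1") (auto intro: remove_sings_analytic_on)
  then have E: "E holomorphic_on UNIV"
    by (simp add: analytic_imp_holomorphic analytic_on_analytic_at[of _ UNIV])
  have E1: "E 1 = 1" unfolding E_def using zeta_residue by (rule remove_sings_eqI)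
  have E_eq: "E s = (s - 1) * zeta s" if "s \<noteq> 1" for s
    unfolding E_def using A[OF that] by (rule remove_sings_at_analytic)
  \<comment> \<open>Since E 1 = 1, the difference quotient of E at 1 is zeta s - 1/(s - 1), and it
    is entire together with E.\<close>
  define Z where "Z = (\<lambda>s. if s = 1 then deriv E 1 else (E s - E 1) / (s - 1))"
  have "Z holomorphic_on UNIV" unfolding Z_def by (rule pole_lemma_open[OF E open_UNIV])
  moreover have "zeta s = 1 / (s - 1) + Z s" if "s \<noteq> 1" for s
    using that by (simp add: Z_def E_eq E1 field_simps)
  ultimately show ?thesis using that by blast
qed

text \<open>
  The subtrahend in \<open>t\<close> is the integral of \<open>x powr -s\<close> over \<open>[n, n + 1]\<close>. These terms add up to
  \<open>zeta s - 1/(s - 1)\<close>, and the bound is uniform in \<open>s\<close>, so that the limit \<open>s \<rightarrow> 1\<close> may be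
  taken termwise.
\<close>
lemma powr_diff_bounds:
  fixes n :: nat
  assumes "s > 1" "s \<le> 2" "n \<ge> 1"
  defines "t \<equiv> 1 / real n powr s - (real n powr (1 - s) - real (Suc n) powr (1 - s)) / (s - 1)"
  shows "\<bar>t\<bar> \<le> 2 / real n ^ 2"
proof -
  have n: "real n \<ge> 1" using assms by simp
  have d: "((\<lambda>x. x powr a) has_real_derivative a * x powr (a - 1)) (at x)" if "x \<ge> real n" for x a
    using that n by (intro has_real_derivative_powr) auto
  obtain x where x: "real n < x" "x < real (Suc n)"
    "real (Suc n) powr (1 - s) - real n powr (1 - s) = (real (Suc n) - real n) * ((1 - s) * x powr (- s))"
    using MVT2[of "real n" "real (Suc n)" "\<lambda>x. x powr (1 - s)" "\<lambda>x. (1 - s) * x powr (1 - s - 1)"] d[of _ "1 - s"]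
    by auto
  have t: "t = real n powr (-s) - x powr (-s)"
  proof -
    have "real n powr (1 - s) - real (Suc n) powr (1 - s) = (s - 1) * x powr (- s)"
      using x(3) by (simp add: algebra_simps)
    then show ?thesis using assms(1) by (simp add: t_def powr_minus_divide)
  qed
  obtain y where y: "real n < y" "y < x"
    "x powr (-s) - real n powr (-s) = (x - real n) * (- s * y powr (- s - 1))"
    using MVT2[of "real n" x "\<lambda>x. x powr (- s)" "\<lambda>x. - s * x powr (- s - 1)"] d[of _ "- s"] x
    by auto
  have "t = (x - real n) * (s * y powr (- s - 1))" using y(3) t by (simp add: algebra_simps)
  then have "\<bar>t\<bar> = (x - real n) * (s * y powr (- s - 1))"
    using x assms by simp
  also have "\<dots> \<le> 1 * (2 * real n powr (-2))"
  proof (intro mult_mono)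
    have "y powr (- s - 1) \<le> real n powr (- s - 1)" using y n assms by (intro powr_mono2') auto
    also have "\<dots> \<le> real n powr (-2)" using n assms by (intro powr_mono) auto
    finally show "y powr (- s - 1) \<le> real n powr (-2)" .
  qed (use x assms in auto)
  also have "\<dots> = 2 / real n ^ 2" using n by (simp add: powr_minus_divide powr_numeral)
  finally show ?thesis .
qed

text \<open>Links \<open>stieltjes 0\<close> to Euler's constant and thereby to
  \<open>- Digamma 1\<close>; without this the simple pole in the expansion of
  \<open>harmonic_zeta\<close> could not be matched with its prescribed coefficient.\<close>

lemma zeta_regular_part_at_1:
  assumes Z: "Z holomorphic_on UNIV" "\<And>s. s \<noteq> 1 \<Longrightarrow> zeta s = 1 / (s - 1) + Z s"
  shows "Z 1 = euler_mascheroni"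
proof -
  define t where "t = (\<lambda>n s. 1 / real (Suc n) powr s - (real (Suc n) powr (1 - s) - real (Suc (Suc n)) powr (1 - s)) / (s - 1))"
  define l where "l = (\<lambda>n. inverse (of_nat (n+1)) + ln (of_nat (n+1)) - ln (of_nat (n+2)) :: real)"
  have ev: "\<forall>\<^sub>F s in at_right 1. 1 < s \<and> s \<le> (2::real)"
    by (rule eventually_at_rightI[of 1 2]) auto
  have t_lim: "(t n \<longlongrightarrow> l n) (at_right 1)" for n
  proof -
    \<comment> \<open>Subtracting 1 from both powers splits the quotient in t into two difference
      quotients of \<open>c powr (1 - s)\<close> at s = 1, each with limit
      \<open>- ln c\<close>.\<close>
    have *: "((\<lambda>s. (c powr (1 - s) - 1) / (s - 1)) \<longlongrightarrow> - ln c) (at_right 1)" if "c > 0" for c :: real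
    proof -
      have "((\<lambda>s. c powr (1 - s)) has_real_derivative - ln c) (at 1)"
        using that by (auto intro!: derivative_eq_intros)
      then have "((\<lambda>s. (c powr (1 - s) - 1) / (s - 1)) \<longlongrightarrow> - ln c) (at 1)"
        using that by (simp add: has_field_derivative_iff)
      then show ?thesis by (rule tendsto_within_subset) auto
    qed
    have "((\<lambda>s. 1 / real (Suc n) powr s - ((real (Suc n) powr (1 - s) - 1) / (s - 1) - (real (Suc (Suc n)) powr (1 - s) - 1) / (s - 1)))
      \<longlongrightarrow> 1 / real (Suc n) powr 1 - (- ln (real (Suc n)) - - ln (real (Suc (Suc n))))) (at_right 1)"
      by (intro tendsto_intros *) auto
    moreover have "1 / real (Suc n) powr 1 - (- ln (real (Suc n)) - - ln (real (Suc (Suc n)))) = l n"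
      by (simp add: l_def divide_inverse add_ac)
    moreover have "(real (Suc n) powr (1 - s) - 1) / (s - 1) - (real (Suc (Suc n)) powr (1 - s) - 1) / (s - 1) =
       (real (Suc n) powr (1 - s) - real (Suc (Suc n)) powr (1 - s)) / (s - 1)" for s
      by (simp flip: diff_divide_distrib)
    ultimately show ?thesis by (simp only: t_def)
  qed
  have bound: "\<forall>\<^sub>F (n, s) in at_top \<times>\<^sub>F at_right 1. norm (t n s) \<le> 2 / real (Suc n) ^ 2"
  proof -
    have "\<forall>\<^sub>F p in (at_top :: nat filter) \<times>\<^sub>F at_right 1. 1 < snd p \<and> snd p \<le> (2::real)"
      using eventually_prod2[of "at_top :: nat filter"  "\<lambda>s. 1 < s \<and> s \<le> (2::real)" "at_right 1"] ev by (simp add: case_prod_unfold)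
    then show ?thesis
    proof eventually_elim
      case (elim p)
      then show ?case
        using powr_diff_bounds[of "snd p" "Suc (fst p)"] unfolding t_def case_prod_unfold real_norm_def by simp
    qed
  qed
  have sm: "summable (\<lambda>n. 2 / real (Suc n) ^ 2)"
    using summable_mult[OF summable_inverse_powr[of 2], of 2] by (simp del: of_nat_Suc)
  have lim: "((\<lambda>s. \<Sum>n. t n s) \<longlongrightarrow> (\<Sum>n. l n)) (at_right 1)"
    using tannerys_theorem[OF t_lim bound sm] by (simp add: trivial_limit_at_right_real)
  have l: "(\<Sum>n. l n) = euler_mascheroni"
    unfolding l_def using euler_mascheroni_sum_real by (simp add: sums_iff)
  have Zt: "complex_of_real (\<Sum>n. t n s) = Z (of_real s)" if s: "s > 1" for s
  proof -
    have "(\<lambda>n. complex_of_real (1 / real (Suc n) powr s)) sums zeta (of_real s)"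
      using zeta_sums[of "of_real s"] s powr_of_real[of "real (Suc _)" s] by (simp del: of_nat_Suc)
    \<comment> \<open>A series of real terms has a real sum, so zeta is real at real s > 1 and the
      comparison can be made between real series.\<close>
    then have 1: "(\<lambda>n. 1 / real (Suc n) powr s) sums Re (zeta (of_real s))"
      "zeta (of_real s) = of_real (Re (zeta (of_real s)))"
      by (metis (no_types, lifting) sums_of_real_iff sums_unique2 sums_Re Re_complex_of_real sums_cong)
         (metis (no_types, lifting) \<open>(\<lambda>n. complex_of_real (1 / real (Suc n) powr s)) sums zeta (of_real s)\<close> sums_of_real sums_unique2 sums_Re Re_complex_of_real sums_cong)
    have "filterlim (\<lambda>n. real (Suc n)) at_top sequentially"
      using filterlim_real_sequentially by (subst filterlim_sequentially_Suc)
    then have "(\<lambda>n. real (Suc n) powr (1 - s)) \<longlonglongrightarrow> 0"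
      using s by (intro tendsto_neg_powr) auto
    \<comment> \<open>The sum is the first term 1^(1-s) = 1 minus the limit 0; after division by s -
      1 it becomes the polar part of zeta.\<close>
    from telescope_sums'[OF this] have "(\<lambda>n. real (Suc n) powr (1 - s) - real (Suc (Suc n)) powr (1 - s)) sums 1" by simp
    from sums_diff[OF 1(1) sums_divide[OF this, of "s - 1"]]
    have "(\<lambda>n. t n s) sums (Re (zeta (of_real s)) - 1 / (s - 1))" by (simp add: t_def)
    then have "complex_of_real (\<Sum>n. t n s) = zeta (of_real s) - 1 / (of_real s - 1)"
      using 1(2) by (simp add: sums_iff)
    then show ?thesis using Z(2)[of "of_real s"] s by simp
  qed
  have "((\<lambda>s. complex_of_real (\<Sum>n. t n s)) \<longlongrightarrow> of_real euler_mascheroni) (at_right 1)"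
    using lim unfolding l by (rule tendsto_of_real)
  then have "((\<lambda>s. Z (of_real s)) \<longlongrightarrow> of_real euler_mascheroni) (at_right 1)"
    by (rule Lim_transform_eventually) (use ev in \<open>eventually_elim, auto simp: Zt\<close>)
  moreover have "isCont Z (of_real 1)"
    using Z(1) holomorphic_on_imp_continuous_on continuous_on_eq_continuous_at[of UNIV Z] by auto
  then have "((\<lambda>s. Z (of_real s)) \<longlongrightarrow> Z (of_real 1)) (at_right 1)"
    by (rule isCont_tendsto_compose) (intro tendsto_intros)
  ultimately show ?thesis
    using tendsto_unique[OF trivial_limit_at_right_real] by (metis of_real_1 of_real_euler_mascheroni)
qed

subsection \<open>The harmonic zeta function\<close>

text \<open>As x tends to 0 the logarithm behaves like -x/2, so the kernel tends to -1/2; this is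
  what lets its transform converge for Re s > 0.\<close>

definition harm_kernel :: "real \<Rightarrow> real" where
  "harm_kernel x = exp (- x) * ln ((1 - exp (- x)) / x) / (1 - exp (- x))"

lemma harm_kernel_measurable [measurable]: "harm_kernel \<in> borel_measurable borel"
  unfolding harm_kernel_def by measurable

text \<open>The factors \<open>(- 1) *\<close> and the exponent 1 are kept so that every summand
  literally fits the linearity rules and the rules for powers of the logarithm.\<close>

lemma harm_kernel_eq:
  assumes "x > 0"
  shows "harm_kernel x = - ln (1 - exp (- x)) + (- 1) * (- ln (1 - exp (- x)) / (1 - exp (- x))) + (- 1) * (ln x ^ 1 * bose x)"
proof -
  define y where "y = 1 - exp (- x)"
  have y: "y \<noteq> 0" "exp (- x) = 1 - y" using assms by (auto simp: y_def)
  have "ln (y / x) = ln y - ln x" using assms by (simp add: ln_div y_def)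
  moreover have "(1 - y) * (ln y - ln x) / y = - ln y + (- 1) * (- ln y / y) + (- 1) * (ln x ^ 1 * ((1 - y) / y))"
    using y by (simp add: field_simps)
  ultimately have "(1 - y) * ln (y / x) / y = - ln y + (- 1) * (- ln y / y) + (- 1) * (ln x ^ 1 * ((1 - y) / y))"
    by simp
  then show ?thesis by (simp add: harm_kernel_def bose_def y(2))
qed

text \<open>The coefficients 1/(n+1) of the logarithm raise the exponent of the Dirichlet series by
  one, which is also why Re s > 0 suffices here.\<close>

lemma mellin_ln:
  assumes "Re s > 0"
  shows mellin_conv_ln: "mellin_conv (\<lambda>x. - ln (1 - exp (- x))) (Re s)"
    and mellin_ln_eq: "mellin (\<lambda>x. - ln (1 - exp (- x))) s = Gamma s * zeta (s + 1)"
proof -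
  have sm: "summable (\<lambda>n. 1 / real (Suc n) / real (Suc n) powr Re s)"
    using summable_inverse_powr[of "Re s + 1"] assms by (simp add: powr_add mult_ac del: of_nat_Suc)
  note d = dirichlet_mellin[of "\<lambda>n. 1 / real (Suc n)", OF _ assms sm ln_exp_sums]
  show "mellin_conv (\<lambda>x. - ln (1 - exp (- x))) (Re s)" using d(1) by simp
  have "(\<lambda>n. 1 / of_nat (Suc n) powr (s + 1)) sums (mellin (\<lambda>x. - ln (1 - exp (- x))) s / Gamma s)"
    using d(2) by (simp add: powr_add mult_ac del: of_nat_Suc)
  then have "mellin (\<lambda>x. - ln (1 - exp (- x))) s / Gamma s = zeta (s + 1)"
    using zeta_sums[of "s + 1"] assms by (auto dest: sums_unique2)
  moreover have "Gamma s \<noteq> 0" using assms by (auto simp: Gamma_eq_zero_iff dest: nonpos_Ints_Re_le)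
  ultimately show "mellin (\<lambda>x. - ln (1 - exp (- x))) s = Gamma s * zeta (s + 1)"
    by (simp add: field_simps)
qed

lemma mellin_harm:
  assumes "Re s > 1"
  shows mellin_conv_harm: "mellin_conv (\<lambda>x. - ln (1 - exp (- x)) / (1 - exp (- x))) (Re s)"
    and mellin_harm_sums: "(\<lambda>n. harm (Suc n) / of_nat (Suc n) powr s) sums
      (mellin (\<lambda>x. - ln (1 - exp (- x)) / (1 - exp (- x))) s / Gamma s)"
proof -
  note d = dirichlet_mellin[of "\<lambda>n. harm (Suc n)", OF harm_nonneg _ summable_harm_powr[OF assms] harm_exp_sums]
  show "mellin_conv (\<lambda>x. - ln (1 - exp (- x)) / (1 - exp (- x))) (Re s)" using d(1) assms by simp
  show "(\<lambda>n. harm (Suc n) / of_nat (Suc n) powr s) sums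
      (mellin (\<lambda>x. - ln (1 - exp (- x)) / (1 - exp (- x))) s / Gamma s)"
    using d(2) assms by (simp add: of_real_harm del: of_nat_Suc)
qed

text \<open>A factor ln x under the transform is a derivative in s, so this is the product rule for
  Gamma * zeta.\<close>

lemma deriv_mellin_bose:
  assumes "Re s > 1"
  shows "mellin (\<lambda>x. ln x ^ 1 * bose x) s = Gamma s * (Digamma s * zeta s + deriv zeta s)"
proof -
  have s: "s \<notin> \<int>\<^sub>\<le>\<^sub>0" "s \<noteq> 1" using assms by (auto dest: nonpos_Ints_Re_le)
  have "mellin_conv bose \<sigma>" if "\<sigma> > 1" for \<sigma>
    using mellin_conv_bose[of "of_real \<sigma>"] that by simp
  then have "mellin (\<lambda>x. ln x ^ 1 * bose x) s = deriv (mellin bose) s"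
    using mellin_higher_deriv[of bose 1 s 1] assms by simp
  also have "\<dots> = deriv (\<lambda>s. Gamma s * zeta s) s"
  proof (rule deriv_cong_ev)
    have "\<forall>\<^sub>F w in nhds s. w \<in> {w. Re w > 1}"
      using assms by (intro eventually_nhds_in_open open_halfspace_Re_gt) auto
    then show "\<forall>\<^sub>F w in nhds s. mellin bose w = Gamma w * zeta w"
    proof eventually_elim
      case (elim w)
      then have "Gamma w \<noteq> 0" by (auto simp: Gamma_eq_zero_iff dest: nonpos_Ints_Re_le)
      then show ?case using elim by (simp add: zeta_eq_mellin)
    qed
  qed simp
  also have "(zeta has_field_derivative deriv zeta s) (at s)"
    using zeta_analytic[OF s(2)] by (simp add: DERIV_deriv_iff_field_differentiable analytic_on_imp_differentiable_at)
  then have "((\<lambda>s. Gamma s * zeta s) has_field_derivative Gamma s * (Digamma s * zeta s + deriv zeta s)) (at s)"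
    using s by (auto intro!: derivative_eq_intros simp: algebra_simps)
  then have "deriv (\<lambda>s. Gamma s * zeta s) s = Gamma s * (Digamma s * zeta s + deriv zeta s)"
    by (rule DERIV_imp_deriv)
  finally show ?thesis .
qed

lemma harm_kernel_mellin:
  assumes "Re s > 1"
  shows mellin_conv_harm_kernel: "mellin_conv harm_kernel (Re s)"
    and mellin_harm_kernel: "(\<lambda>n. harm (Suc n) / of_nat (Suc n) powr s) sums
      (zeta (s + 1) - deriv zeta s - Digamma s * zeta s - rGamma s * mellin harm_kernel s)"
proof -
  let ?A = "\<lambda>x::real. - ln (1 - exp (- x))" and ?B = "\<lambda>x::real. - ln (1 - exp (- x)) / (1 - exp (- x))"
    and ?C = "\<lambda>x::real. ln x ^ 1 * bose x"
  have bose: "mellin_conv bose \<sigma>" if "\<sigma> > 1" for \<sigma>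
    using mellin_conv_bose[of "of_real \<sigma>"] that by simp
  have A: "mellin_conv ?A (Re s)" using assms by (intro mellin_conv_ln) auto
  have B: "mellin_conv (\<lambda>x. (- 1) * ?B x) (Re s)"
    by (rule mellin_conv_cmult[OF mellin_conv_harm[OF assms]])
  have C: "mellin_conv (\<lambda>x. (- 1) * ?C x) (Re s)"
    \<comment> \<open>The margin (Re s - 1)/2 for the logarithm stays to the right of the line Re s
      = 1.\<close>
    by (rule mellin_conv_cmult, rule mellin_conv_ln_power[of _ _ "(Re s - 1) / 2"])
       (use assms in \<open>auto intro!: bose simp: field_simps\<close>)
  have AB: "mellin_conv (\<lambda>x. ?A x + (- 1) * ?B x) (Re s)" by (rule mellin_conv_add[OF A B])
  have "mellin_conv (\<lambda>x. ?A x + (- 1) * ?B x + (- 1) * ?C x) (Re s)"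
    by (rule mellin_conv_add[OF AB C])
  also have "?this \<longleftrightarrow> mellin_conv harm_kernel (Re s)"
    by (rule mellin_conv_cong) (simp only: harm_kernel_eq)
  finally show "mellin_conv harm_kernel (Re s)" .
  have "mellin harm_kernel s = mellin (\<lambda>x. ?A x + (- 1) * ?B x + (- 1) * ?C x) s"
    by (rule mellin_cong) (simp only: harm_kernel_eq)
  also have "\<dots> = mellin (\<lambda>x. ?A x + (- 1) * ?B x) s + mellin (\<lambda>x. (- 1) * ?C x) s"
    by (rule mellin_add[OF _ _ AB C]) measurable
  also have "mellin (\<lambda>x. ?A x + (- 1) * ?B x) s = mellin ?A s + mellin (\<lambda>x. (- 1) * ?B x) s"
    by (rule mellin_add[OF _ _ A B]) measurable
  finally have eq: "mellin harm_kernel s = Gamma s * zeta (s + 1) - mellin ?B s - Gamma s * (Digamma s * zeta s + deriv zeta s)"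
    unfolding mellin_cmult deriv_mellin_bose[OF assms] using mellin_ln_eq[of s] assms by simp
  have "Gamma s \<noteq> 0" using assms by (auto simp: Gamma_eq_zero_iff dest: nonpos_Ints_Re_le)
  then have "mellin ?B s / Gamma s =
      zeta (s + 1) - deriv zeta s - Digamma s * zeta s - rGamma s * mellin harm_kernel s"
    using eq by (simp add: rGamma_inverse_Gamma field_simps)
  then show "(\<lambda>n. harm (Suc n) / of_nat (Suc n) powr s) sums
      (zeta (s + 1) - deriv zeta s - Digamma s * zeta s - rGamma s * mellin harm_kernel s)"
    using mellin_harm_sums[OF assms] by simp
qed

text \<open>Since p 0 = 1, the function Ln p vanishes at 0 and Ln p(z) / z is holomorphic there.
  Multiplied by e^-z / p(z), which is z e^-z / (1 - e^-z), it extends the kernel holomorphically to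
  a neighbourhood of 0.\<close>

lemma harm_kernel_continuation:
  obtains G where "G meromorphic_on UNIV" "\<And>s. Re s > 0 \<Longrightarrow> mellin_conv harm_kernel (Re s)"
    "\<And>s. Re s > 0 \<Longrightarrow> G s = mellin harm_kernel s"
proof -
  obtain r p where p: "r > 0" "p holomorphic_on ball 0 r" "p (0::complex) = 1"
    "\<And>z. z \<noteq> 0 \<Longrightarrow> p z = (1 - exp (- z)) / z" "\<And>z. z \<in> ball 0 r \<Longrightarrow> Re (p z) > 0"
    using one_minus_exp_quotient by blast
  have nz: "p z \<noteq> 0" if "z \<in> ball 0 r" for z using p(5)[OF that] by auto
  have nonpos: "p z \<notin> \<real>\<^sub>\<le>\<^sub>0" if "z \<in> ball 0 r" for z
    using p(5)[OF that] by (auto simp: complex_nonpos_Reals_iff)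
  define f where "f = (\<lambda>z. Ln (p z))"
  have f: "f holomorphic_on ball 0 r"
    unfolding f_def using p(2) nonpos by (intro holomorphic_intros) auto
  define l where "l = (\<lambda>z. if z = 0 then deriv f 0 else (f z - f 0) / (z - 0))"
  have l: "l holomorphic_on ball 0 r"
    unfolding l_def by (rule pole_lemma_open[OF f]) auto
  have 1: "(\<lambda>z. exp (- z) / p z * l z) holomorphic_on ball 0 r"
    using p(2) nz l by (intro holomorphic_intros) auto
  have 2: "exp (- complex_of_real x) / p (of_real x) * l (of_real x) = of_real (harm_kernel x)" if "0 < x" for x
  proof -
    have q: "(1 - exp (- x)) / x > 0" using that by simp
    have "p (of_real x) = of_real ((1 - exp (- x)) / x)"
      using that by (simp add: p(4) exp_of_real flip: of_real_minus)
    moreover from this q have "l (of_real x) = of_real (ln ((1 - exp (- x)) / x) / x)"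
      using that by (simp add: l_def f_def p(3) Ln_of_real del: of_real_divide) simp
    moreover have "exp (- complex_of_real x) = of_real (exp (-x))" by (simp add: exp_of_real flip: of_real_minus)
    ultimately show ?thesis using that by (simp add: harm_kernel_def)
  qed
  have 3: "mellin_conv harm_kernel \<sigma>" if "\<sigma> > 1" for \<sigma>
    using mellin_conv_harm_kernel[of "of_real \<sigma>"] that by simp
  show ?thesis
    by (rule mellin_continuation[OF harm_kernel_measurable p(1) 1 2 3]) (use that in auto)
qed

lemma mellin_conv_harm_kernel_pos: "\<sigma> > 0 \<Longrightarrow> mellin_conv harm_kernel \<sigma>"
  using harm_kernel_continuation by (metis Re_complex_of_real)

lemma harmonic_zeta_eq:
  assumes "Re s > 0" "s \<noteq> 1"
  shows "harmonic_zeta s = zeta (s + 1) - deriv zeta s - Digamma s * zeta s - rGamma s * mellin harm_kernel s"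
proof -
  obtain G where G: "G meromorphic_on UNIV" "\<And>s. Re s > 0 \<Longrightarrow> G s = mellin harm_kernel s"
    using harm_kernel_continuation by metis
  define F where "F = (\<lambda>s. zeta (s + 1) - deriv zeta s - Digamma s * zeta s - rGamma s * mellin harm_kernel s)"
  \<comment> \<open>F is the formula on Re s > 0, R its counterpart on the whole plane:
    \<open>- Digamma\<close> becomes the logarithmic derivative of the entire function
    \<open>rGamma\<close>, visibly meromorphic, and the transform becomes its continuation
    G.\<close>
  define R where "R = (\<lambda>s. zeta (s + 1) - deriv zeta s + deriv rGamma s / rGamma s * zeta s - rGamma s * G s)"
  have zeta: "zeta meromorphic_on UNIV" using zeta_nicely_meromorphic by (simp add: nicely_meromorphic_on_def)
  have rG: "rGamma meromorphic_on UNIV" by (intro analytic_on_imp_meromorphic_on analytic_rGamma)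
  have "(\<lambda>s. zeta (s + 1)) meromorphic_on UNIV"
    by (intro meromorphic_on_compose[OF zeta] analytic_intros) auto
  then have R: "R meromorphic_on UNIV"
    unfolding R_def using zeta rG G(1) by (intro meromorphic_intros)
  have R_eq: "R s = F s" if "Re s > 0" for s
  proof -
    have s: "s \<notin> \<int>\<^sub>\<le>\<^sub>0" using that by (auto dest: nonpos_Ints_Re_le)
    have "deriv rGamma s = - rGamma s * Digamma s"
      by (rule DERIV_imp_deriv, rule has_field_derivative_rGamma_no_nonpos_int[OF s])
    moreover have "rGamma s \<noteq> 0" using s by (simp add: rGamma_eq_zero_iff)
    ultimately show ?thesis using that by (simp add: R_def F_def G(2))
  qed
  have F_analytic: "F analytic_on {s}" if s: "Re s > 0" "s \<noteq> 1" for s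
  proof -
    have "(zeta \<circ> (\<lambda>s. s + 1)) analytic_on {s}"
      by (rule analytic_on_compose_gen[of _ _ _ "{s + 1}"])
         (use s in \<open>auto intro!: analytic_intros zeta_analytic\<close>)
    moreover have "mellin harm_kernel analytic_on {s}"
      by (rule mellin_analytic_at[of _ 0]) (use s mellin_conv_harm_kernel_pos in auto)
    moreover have "Digamma analytic_on {s}"
      using s by (intro analytic_on_Polygamma) (auto dest: nonpos_Ints_Re_le)
    ultimately show ?thesis
      unfolding F_def o_def using zeta_analytic[OF s(2)]
      by (intro analytic_on_diff analytic_on_mult analytic_deriv analytic_rGamma)
  qed
  have R_analytic: "R analytic_on {s}" if s: "Re s > 0" "s \<noteq> 1" for s
  proof -
    have "\<forall>\<^sub>F w in nhds s. w \<in> {w. Re w > 0}"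
      using s by (intro eventually_nhds_in_open open_halfspace_Re_gt) auto
    then have "\<forall>\<^sub>F w in nhds s. R w = F w" by eventually_elim (auto simp: R_eq)
    then show ?thesis using F_analytic[OF s] by (subst analytic_at_cong) auto
  qed
  have "harmonic_zeta = remove_sings R"
    unfolding harmonic_zeta_def
  proof (rule meromorphic_continuation_eq_remove_sings[OF R _ halfplane_nonempty])
    fix s assume s: "s \<in> {s. Re s > 1}"
    show "R analytic_on {s}" using s by (intro R_analytic) auto
    show "R s = (\<Sum>n. harm (Suc n) / of_nat (Suc n) powr s)"
      using mellin_harm_kernel[of s] s R_eq[of s] by (simp add: sums_iff F_def)
  qed (rule open_halfspace_Re_gt)
  then show ?thesis using remove_sings_at_analytic[OF R_analytic] assms R_eq by (simp add: F_def)
qed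

subsection \<open>Stieltjes constants\<close>

lemma stieltjes_eq:
  assumes Z: "Z holomorphic_on UNIV" "\<And>s. s \<noteq> 1 \<Longrightarrow> zeta s = 1 / (s - 1) + Z s"
  shows "stieltjes = (\<lambda>m. (-1) ^ m * (deriv ^^ m) Z 1)"
proof -
  have "stieltjes = (THE c. \<forall>s. s \<in> - {1} \<longrightarrow>
     (\<lambda>m. (-1) ^ m * c m / fact m * (s - 1) ^ m) sums (zeta s - 1 / (s - 1)))"
    by (simp add: stieltjes_def)
  also have "\<dots> = (\<lambda>m. (-1) ^ m * (deriv ^^ m) Z 1)"
  proof (rule the_taylor_coeffs[of _ _ _ 1])
    fix s :: complex assume "s \<in> - {1}"
    then show "zeta s - 1 / (s - 1) = Z s" by (simp add: Z(2))
    show "\<exists>r. s \<in> ball 1 r \<and> Z holomorphic_on ball 1 r"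
      by (intro exI[of _ "dist 1 s + 1"]) (auto intro: holomorphic_on_subset[OF Z(1)])
  qed auto
  finally show ?thesis .
qed

text \<open>In terms of Taylor coefficients this is an index shift. In the Leibniz rule for (s - a)
  D(s) at a only the term with exactly one derivative on s - a survives.\<close>

lemma higher_deriv_quotient_at:
  assumes f: "f holomorphic_on S" and D: "D holomorphic_on S" and S: "open S" "a \<in> S"
    and eq: "\<And>s. s \<in> S \<Longrightarrow> f s = f a + (s - a) * D s"
  shows "(deriv ^^ n) D a = (deriv ^^ (n + 1)) f a / of_nat (n + 1)"
proof -
  have "(deriv ^^ (n + 1)) f a = (deriv ^^ (n + 1)) (\<lambda>s. f a + (s - a) * D s) a"
    by (rule higher_deriv_transform_within_open[OF f _ S eq]) (intro holomorphic_intros D)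
  also have "\<dots> = (deriv ^^ (n + 1)) (\<lambda>s. f a) a + (deriv ^^ (n + 1)) (\<lambda>s. (s - a) * D s) a"
    by (rule higher_deriv_add[of _ S]) (use D S in \<open>auto intro!: holomorphic_intros\<close>)
  also have "(deriv ^^ (n + 1)) (\<lambda>s. f a) a = 0" by (simp add: higher_deriv_const)
  also have "(deriv ^^ (n + 1)) (\<lambda>s. (s - a) * D s) a =
      (\<Sum>i = 0..n + 1. of_nat (n + 1 choose i) * (deriv ^^ i) (\<lambda>s. s - a) a * (deriv ^^ (n + 1 - i)) D a)"
    by (rule higher_deriv_mult[of _ S]) (use D S in \<open>auto intro!: holomorphic_intros\<close>)
  also have "\<dots> = (\<Sum>i = 0..n + 1. if i = 1 then of_nat (n + 1) * (deriv ^^ n) D a else 0)"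
  proof (rule sum.cong)
    fix i
    have "(deriv ^^ i) (\<lambda>s. s - a) a = (if i = 1 then 1 else 0)"
      by (subst higher_deriv_diff[of _ UNIV])
         (auto intro!: holomorphic_intros simp: higher_deriv_ident higher_deriv_const)
    then show "of_nat (n + 1 choose i) * (deriv ^^ i) (\<lambda>s. s - a) a * (deriv ^^ (n + 1 - i)) D a =
        (if i = 1 then of_nat (n + 1) * (deriv ^^ n) D a else 0)"
      by simp
  qed simp
  also have "\<dots> = of_nat (n + 1) * (deriv ^^ n) D a" by (simp add: sum.delta)
  finally show ?thesis by (simp add: field_simps del: of_nat_Suc)
qed

section \<open>Comparison of Taylor coefficients at 1\<close>

lemma log_integral_eq_mellin: "of_real (log_integral k) = mellin (\<lambda>x. ln x ^ k * harm_kernel x) 1"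
proof -
  have "log_integral k = (LINT x:{0<..}|lborel. x powr (1 - 1) * (ln x ^ k * harm_kernel x))"
    unfolding log_integral_def by (rule set_lebesgue_integral_cong) (auto simp: harm_kernel_def)
  then show ?thesis using mellin_of_real[of "\<lambda>x. ln x ^ k * harm_kernel x" 1] by simp
qed

theorem proposition13:
  fixes n :: nat
  shows "harmonic_stieltjes n =
      (-1) ^ n * (deriv ^^ n) zeta 2 + stieltjes (n + 1)
    - (-1) ^ n * ((deriv ^^ (n + 1)) Digamma 1 / of_nat (n + 1))
    - (-1) ^ n * (\<Sum>k=0..n. of_nat (n choose k) *
        (inv_Gamma_deriv k * of_real (log_integral (n - k))
         + (-1) ^ (n - k) * stieltjes (n - k) * (deriv ^^ k) Digamma 1))"
proof -
  obtain Z where Z: "Z holomorphic_on UNIV" "\<And>s. s \<noteq> 1 \<Longrightarrow> zeta s = 1 / (s - 1) + Z s"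
    using zeta_regular_part by blast
  note st = stieltjes_eq[OF Z]
  have Z1: "Z 1 = euler_mascheroni" by (rule zeta_regular_part_at_1[OF Z])
  \<comment> \<open>The largest disc around 1 inside Re s > 0, where the transform of
    \<open>harm_kernel\<close> converges; it is also the disc in the definition of
    \<open>harmonic_stieltjes\<close>.\<close>
  let ?B = "ball (1::complex) 1"
  have B: "Re s > 0" if "s \<in> ?B" for s
    using that abs_Re_le_cmod[of "1 - s"] by (simp add: dist_norm)
  \<comment> \<open>The holomorphic remainder in Digamma s / (s - 1) = Digamma 1 / (s - 1) + D
    s.\<close>
  define D :: "complex \<Rightarrow> complex" where "D = (\<lambda>s. if s = 1 then deriv Digamma 1 else (Digamma s - Digamma 1) / (s - 1))"
  define I where "I = mellin harm_kernel"
  \<comment> \<open>What remains of the formula for \<open>harmonic_zeta\<close> after zeta s = 1/(s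
    - 1) + Z s is inserted and both polar terms are removed: -zeta' leaves -Z', and -Digamma * zeta
    leaves -D - Digamma * Z.\<close>
  define W where "W = (\<lambda>s. zeta (s + 1) - deriv Z s - D s - (rGamma s * I s + Digamma s * Z s))"
  have hol_psi: "Digamma holomorphic_on ?B"
    by (intro holomorphic_on_Polygamma) (auto dest!: nonpos_Ints_Re_le B simp del: mem_ball)
  have hol_D: "D holomorphic_on ?B" unfolding D_def by (rule pole_lemma_open[OF hol_psi]) auto
  have hol_I: "I holomorphic_on ?B"
    unfolding I_def
    by (intro analytic_imp_holomorphic, subst analytic_on_analytic_at, intro ballI mellin_analytic_at[of _ 0])
       (use B mellin_conv_harm_kernel_pos in \<open>auto simp del: mem_ball\<close>)
  have hol_zeta: "zeta holomorphic_on {s. Re s > 1}"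
    by (intro analytic_imp_holomorphic, subst analytic_on_analytic_at) (auto intro: zeta_analytic)
  have hol_zeta1: "(\<lambda>s. zeta (s + 1)) holomorphic_on ?B"
  proof -
    have "(\<lambda>s. s + 1) ` ?B \<subseteq> {s. Re s > 1}" using B by fastforce
    then show ?thesis
      using holomorphic_on_compose_gen[OF _ hol_zeta, of "\<lambda>s. s + 1" ?B]
      by (simp add: o_def holomorphic_intros)
  qed
  have hol_Z: "Z holomorphic_on ?B" and hol_Z': "deriv Z holomorphic_on ?B"
    using Z(1) by (auto intro: holomorphic_on_subset[of _ UNIV] holomorphic_deriv)
  note hols = hol_psi hol_D hol_I hol_zeta1 hol_Z hol_Z' holomorphic_rGamma open_ball
  have hol_W: "W holomorphic_on ?B" unfolding W_def by (intro holomorphic_intros hols)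
  have W_eq: "harmonic_zeta s - 1 / (s - 1)\<^sup>2 - stieltjes 0 / (s - 1) = W s"
    if s: "0 < norm (s - 1)" "norm (s - 1) < 1" for s
  proof -
    have s1: "s \<noteq> 1" "s \<in> ?B" using s by (auto simp: dist_norm norm_minus_commute)
    have dz: "deriv zeta s = - 1 / (s - 1)\<^sup>2 + deriv Z s"
    proof -
      have "deriv zeta s = deriv (\<lambda>s. 1 / (s - 1) + Z s) s"
      proof (rule deriv_cong_ev)
        have "\<forall>\<^sub>F w in nhds s. w \<in> - {1}" using s1 by (intro eventually_nhds_in_open) auto
        then show "\<forall>\<^sub>F w in nhds s. zeta w = 1 / (w - 1) + Z w" by eventually_elim (simp add: Z(2))
      qed simp
      also have "(Z has_field_derivative deriv Z s) (at s)"
        using Z(1) by (auto intro: holomorphic_derivI)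
      then have "((\<lambda>s. 1 / (s - 1) + Z s) has_field_derivative - 1 / (s - 1)\<^sup>2 + deriv Z s) (at s)"
        using s1 by (auto intro!: derivative_eq_intros simp: power2_eq_square)
      then have "deriv (\<lambda>s. 1 / (s - 1) + Z s) s = - 1 / (s - 1)\<^sup>2 + deriv Z s" by (rule DERIV_imp_deriv)
      finally show ?thesis .
    qed
    \<comment> \<open>Both sides are Euler's constant, so the simple pole of -Digamma * zeta is
      exactly the prescribed one.\<close>
    have st0: "stieltjes 0 = - Digamma 1" by (simp add: st Z1)
    show ?thesis
      unfolding W_def I_def D_def harmonic_zeta_eq[OF B[OF s1(2)] s1(1)] dz Z(2)[OF s1(1)] st0
      using s1(1) by (simp add: ring_distribs diff_divide_distrib add_divide_distrib)
  qed
  have "harmonic_stieltjes = (THE c. \<forall>s. s \<in> {s. 0 < norm (s - 1) \<and> norm (s - 1) < 1} \<longrightarrow>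
     (\<lambda>m. (-1) ^ m * c m / fact m * (s - 1) ^ m)
       sums (harmonic_zeta s - 1 / (s - 1)\<^sup>2 - stieltjes 0 / (s - 1)))"
    by (simp add: harmonic_stieltjes_def)
  also have "\<dots> = (\<lambda>m. (-1) ^ m * (deriv ^^ m) W 1)"
    by (rule the_taylor_coeffs[of _ _ _ 1])
       (use hol_W W_eq in \<open>auto intro!: exI[of _ 1] simp: dist_norm norm_minus_commute\<close>)
  finally have hs: "harmonic_stieltjes n = (-1) ^ n * (deriv ^^ n) W 1" by (rule fun_cong)
  \<comment> \<open>\<open>Gamma\<close> is defined as the inverse of \<open>rGamma\<close>, so
    1/Gamma and \<open>rGamma\<close> are the same function, even at the poles of Gamma, where
    \<open>Gamma\<close> takes the value 0.\<close>
  have inv_Gamma: "(deriv ^^ k) rGamma 1 = inv_Gamma_deriv k" for k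
    by (simp add: inv_Gamma_deriv_def Gamma_def divide_inverse)
  have deriv_I: "(deriv ^^ k) I 1 = of_real (log_integral k)" for k
    unfolding I_def log_integral_eq_mellin
    by (rule mellin_higher_deriv[of _ 0]) (use mellin_conv_harm_kernel_pos in auto)
  have "(deriv ^^ n) W 1 = (deriv ^^ n) (\<lambda>s. zeta (s + 1)) 1 - (deriv ^^ n) (deriv Z) 1 - (deriv ^^ n) D 1
     - ((deriv ^^ n) (\<lambda>s. rGamma s * I s) 1 + (deriv ^^ n) (\<lambda>s. Digamma s * Z s) 1)"
    unfolding W_def using hols
    by (simp add: higher_deriv_diff[of _ ?B] higher_deriv_add[of _ ?B] holomorphic_on_diff holomorphic_on_mult holomorphic_on_add)
  also have "(deriv ^^ n) (\<lambda>s. zeta (s + 1)) 1 = (deriv ^^ n) zeta 2"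
    using higher_deriv_compose_linear'[of zeta "{s. Re s > 1}" ?B 1 1 1 n] hol_zeta B
    by (simp add: open_halfspace_Re_gt del: mem_ball)
  also have "(deriv ^^ n) (deriv Z) 1 = (deriv ^^ (n + 1)) Z 1"
    by (simp add: funpow_swap1)
  also have "(deriv ^^ n) D 1 = (deriv ^^ (n + 1)) Digamma 1 / of_nat (n + 1)"
    by (rule higher_deriv_quotient_at[OF hol_psi hol_D]) (auto simp: D_def)
  also have "(deriv ^^ n) (\<lambda>s. rGamma s * I s) 1 =
      (\<Sum>k=0..n. of_nat (n choose k) * (deriv ^^ k) rGamma 1 * (deriv ^^ (n - k)) I 1)"
    by (rule higher_deriv_mult[of _ ?B]) (use hols in auto)
  also have "(deriv ^^ n) (\<lambda>s. Digamma s * Z s) 1 =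
      (\<Sum>k=0..n. of_nat (n choose k) * (deriv ^^ k) Digamma 1 * (deriv ^^ (n - k)) Z 1)"
    by (rule higher_deriv_mult[of _ ?B]) (use hols in auto)
  finally have W: "(deriv ^^ n) W 1 = (deriv ^^ n) zeta 2 - (deriv ^^ (n + 1)) Z 1
      - (deriv ^^ (n + 1)) Digamma 1 / of_nat (n + 1)
      - ((\<Sum>k=0..n. of_nat (n choose k) * inv_Gamma_deriv k * of_real (log_integral (n - k)))
        + (\<Sum>k=0..n. of_nat (n choose k) * (deriv ^^ k) Digamma 1 * (deriv ^^ (n - k)) Z 1))"
    unfolding inv_Gamma deriv_I .
  have cancel: "(-1) ^ m * stieltjes m = (deriv ^^ m) Z 1" for m
    by (simp add: st flip: mult.assoc power_mult_distrib)
  \<comment> \<open>The additional sign in (-1)^(n+1) turns the contribution of -Z' into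
    \<open>+ stieltjes (n + 1)\<close>.\<close>
  have "stieltjes (n + 1) = - ((-1) ^ n * (deriv ^^ (n + 1)) Z 1)" by (simp add: st)
  moreover have "(\<Sum>k=0..n. of_nat (n choose k) *
        (inv_Gamma_deriv k * of_real (log_integral (n - k))
         + (-1) ^ (n - k) * stieltjes (n - k) * (deriv ^^ k) Digamma 1)) =
      (\<Sum>k=0..n. of_nat (n choose k) * inv_Gamma_deriv k * of_real (log_integral (n - k)))
        + (\<Sum>k=0..n. of_nat (n choose k) * (deriv ^^ k) Digamma 1 * (deriv ^^ (n - k)) Z 1)"
    unfolding cancel by (simp add: algebra_simps sum.distrib)
  ultimately show ?thesis unfolding hs W by (simp only: right_diff_distrib) simp
qed

end
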